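(* Let $F=f+\psi$ be as in the context, and suppose that the smoothness assumption (with vector $L$) and the local quadratic error bound assumption hold. Let $x_0\in\operatorname{dom}(F)$, and consider the adaptively restarted accelerated gradient algorithm AdaRES$(x_0)$ with parameters $\epsilon$ and $\mu_0$ described in the context, where $\mu_0$ is the initial estimate of the local quadratic error bound. Let $\hat N$ be the number of iterations it returns. If $\mu_0\le\mu_F(L,x_0)$, then $$\hat N\le\left\lceil 2\sqrt{\frac{e}{\mu_0}}-1\right\rceil\left\lceil\ln\frac{2(F(x_0)-F^\star)}{\epsilon}\right\rceil+2 .$$ If $\mu_0>\mu_F(L,x_0)$, then $$\hat N\le 1+\left\lceil\log_2\frac{\mu_0}{\mu_F(L,x_0)}\right\rceil+\frac{2\sqrt e}{\sqrt2-1}\left(\sqrt{\frac{2}{\mu_F(L,x_0)}}-\sqrt{\frac1{\mu_0}}\right)\left\lceil\ln\frac{32(F(x_0)-F^\star)}{\epsilon\,\mu_F(L,x_0)}\right\rceil+\left\lceil\frac{2\sqrt{2e}}{\sqrt{\mu_F(L,x_0)}}\right\rceil\left\lceil\ln\frac{2(F(x_0)-F^\star)}{\epsilon}\right\rceil .$$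
   Context: Setting: $f:\mathbb R^n\to\mathbb R$ is convex and differentiable, $\psi:\mathbb R^n\to\mathbb R\cup\{+\infty\}$ is proper, closed and convex, $F:=f+\psi$, $F^\star:=\min_{\mathbb R^n}F$, and the set $\mathcal X_\star$ of minimizers of $F$ is nonempty. For a vector $v$ with positive entries, $\|x\|_v^2:=\sum_{i=1}^n v_i(x^i)^2$, and $\operatorname{dist}_v(x,\mathcal X_\star)$ is the distance from $x$ to $\mathcal X_\star$ in the norm $\|\cdot\|_v$. Smoothness assumption: there is $L\in\mathbb R^n$ with positive entries such that $f(x)\le f(y)+\langle\nabla f(y),x-y\rangle+\frac12\|x-y\|_L^2$ for all $x,y\in\mathbb R^n$. Local quadratic error bound assumption: for every $x_0\in\operatorname{dom}(F)$ there is a constant $\mu_F(L,x_0)>0$ such that $F(x)\ge F^\star+\frac{\mu_F(L,x_0)}{2}\operatorname{dist}_L(x,\mathcal X_\star)^2$ for all $x$ with $F(x)\le F(x_0)$. Proximal mapping: $T(x):=\arg\min_{y\in\mathbb R^n}\{\langle\nabla f(x),y-x\rangle+\frac12\|y-x\|_L^2+\psi(y)\}$. Sequence $(\theta_k)$: $\theta_0=1$, $\theta_{k+1}=\frac{\sqrt{\theta_k^4+4\theta_k^2}-\theta_k^2}{2}$. For $\mu>0$, $K(\mu):=\lceil 2\sqrt{e/\mu}-1\rceil$; it is used as a restarting period, and restarting periods are understood to be integers $\ge1$. FISTA$(x_0,K)$: set $z_0=x_0$; for $k=0,\dots,K-1$ set $y_k=(1-\theta_k)x_k+\theta_kz_k$,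 $x_{k+1}=\arg\min_{x}\{\langle\nabla f(y_k),x-y_k\rangle+\frac12\|x-y_k\|_L^2+\psi(x)\}$, $z_{k+1}=z_k+\frac1{\theta_k}(x_{k+1}-y_k)$. The output is $x_K$. APG$(x_0,K)$: set $z_0=x_0$; for $k=0,\dots,K-1$ set $y_k=(1-\theta_k)x_k+\theta_kz_k$, $z_{k+1}=\arg\min_{z}\{\langle\nabla f(y_k),z-y_k\rangle+\frac{\theta_k}2\|z-z_k\|_L^2+\psi(z)\}$, $x_{k+1}=y_k+\theta_k(z_{k+1}-z_k)$. The output is $x_K$. AdaRES$(x_0)$ with parameters $\epsilon>0$ and $\mu_0>0$: put $t_{-1}=0$, $x_{-1,0}=x_0$, $x_{0,0}=T(x_0)$. For $s=0,1,2,\dots$ do the following. Set $C_s=\frac{16\|x_{s,0}-x_{s-1,t_{s-1}}\|_L^2}{\mu_s}$ and $K_s=K(\mu_s)$. Starting with $t=0$, repeat [let $x_{s,t+1}$ be the output of FISTA$(x_{s,t},K_s)$ or of APG$(x_{s,t},K_s)$; increase $t$ by one] until $\|T(x_{s,t})-x_{s,t}\|_L^2>C_s(\theta_{K_s-1}^2/\mu_s)^t$ or $\|T(x_{s,t})-x_{s,t}\|_L^2\le\epsilon$ (the test is made after each pass). Let $t_s$ be the value of $t$ at exit, set $x_{s+1,0}=T(x_{s,t_s})$ and $\mu_{s+1}=\mu_s/2$. If $\|x_{s+1,0}-x_{s,t_s}\|_L^2\le\epsilon$, stop; otherwise continue with $s+1$. On stopping, let $\hat s$ be the last value of $s$, and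 return $\hat x=T(x_{\hat s,t_{\hat s}})$, $\hat s$, and $\hat N=1+\sum_{s=0}^{\hat s}(t_sK_s+1)$ (the total number of proximal gradient mappings).
   Formalization: The formal theorem additionally assumes ε < 2(F(x_0) − F* ); otherwise the first bound is at most 2 (or has ln 0), while at least one pass is always made and so N̂ ≥ 3. Restarting periods ≥ 1 is rendered as K(μ_0) ≥ 1. *)

theory Defs
  imports "HOL-Analysis.Analysis"
begin

section \<open>Composite objectives\<close>

text \<open>A function \<open>\<psi>\<close> with values in the reals and \<open>+\<infinity>\<close> is an \<open>ereal\<close>-valued
  function that avoids \<open>-\<infinity>\<close>; this is part of properness. Convexity and closedness are
  those of the epigraph, which lives over the real (not extended real) line.\<close>

definition epi :: "('a \<Rightarrow> ereal) \<Rightarrow> ('a \<times> real) set" where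
  "epi psi = {(x, r). psi x \<le> ereal r}"

definition proper_fun :: "('a \<Rightarrow> ereal) \<Rightarrow> bool" where
  "proper_fun psi \<longleftrightarrow> (\<forall>x. psi x \<noteq> -\<infinity>) \<and> (\<exists>x. psi x \<noteq> \<infinity>)"

definition closed_fun :: "('a::topological_space \<Rightarrow> ereal) \<Rightarrow> bool" where
  "closed_fun psi \<longleftrightarrow> closed (epi psi)"

definition convex_fun :: "('a::real_vector \<Rightarrow> ereal) \<Rightarrow> bool" where
  "convex_fun psi \<longleftrightarrow> convex (epi psi)"

definition objective :: "('a \<Rightarrow> real) \<Rightarrow> ('a \<Rightarrow> ereal) \<Rightarrow> 'a \<Rightarrow> ereal" where
  "objective f psi x = ereal (f x) + psi x"

definition eff_dom :: "('a \<Rightarrow> ereal) \<Rightarrow> 'a set" where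
  "eff_dom F = {x. F x < \<infinity>}"

definition min_value :: "('a \<Rightarrow> ereal) \<Rightarrow> ereal" where
  "min_value F = (INF x. F x)"

definition minimizers :: "('a \<Rightarrow> ereal) \<Rightarrow> 'a set" where
  "minimizers F = {x. \<forall>y. F x \<le> F y}"

text \<open>The gap \<open>F(x) - F\<^sup>\<star>\<close> as a real number; it is meaningful for \<open>x\<close> in the domain of
  a proper \<open>F\<close> that has a minimizer.\<close>

definition gap :: "('a \<Rightarrow> ereal) \<Rightarrow> 'a \<Rightarrow> real" where
  "gap F x = real_of_ereal (F x - min_value F)"

definition gradient :: "('a::real_inner \<Rightarrow> real) \<Rightarrow> 'a \<Rightarrow> 'a" where
  "gradient f x = (THE g. GDERIV f x :> g)"

definition wnorm :: "real^'n \<Rightarrow> real^'n \<Rightarrow> real" where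
  "wnorm v x = sqrt (\<Sum>i\<in>UNIV. v $ i * (x $ i)\<^sup>2)"

definition wdist :: "real^'n \<Rightarrow> real^'n \<Rightarrow> (real^'n) set \<Rightarrow> real" where
  "wdist v x S = (INF y\<in>S. wnorm v (x - y))"

definition smooth_wrt :: "(real^'n \<Rightarrow> real) \<Rightarrow> real^'n \<Rightarrow> bool" where
  "smooth_wrt f L \<longleftrightarrow>
     (\<forall>x y. f x \<le> f y + gradient f y \<bullet> (x - y) + 1/2 * (wnorm L (x - y))\<^sup>2)"

definition local_quadratic_error_bound ::
    "(real^'n \<Rightarrow> ereal) \<Rightarrow> real^'n \<Rightarrow> (real^'n \<Rightarrow> real^'n \<Rightarrow> real) \<Rightarrow> bool" where
  "local_quadratic_error_bound F L muF \<longleftrightarrow>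
     (\<forall>x0\<in>eff_dom F. muF L x0 > 0 \<and>
        (\<forall>x. F x \<le> F x0 \<longrightarrow>
           F x \<ge> min_value F + ereal (muF L x0 / 2 * (wdist L x (minimizers F))\<^sup>2)))"


section \<open>Accelerated proximal gradient methods\<close>

definition prox_grad ::
    "(real^'n \<Rightarrow> real) \<Rightarrow> (real^'n \<Rightarrow> ereal) \<Rightarrow> real^'n \<Rightarrow> real^'n \<Rightarrow> real^'n" where
  "prox_grad f psi L x =
     (ARG_MIN (\<lambda>y. ereal (gradient f x \<bullet> (y - x) + 1/2 * (wnorm L (y - x))\<^sup>2) + psi y) y. True)"

fun theta :: "nat \<Rightarrow> real" where
  "theta 0 = 1"
| "theta (Suc k) = (sqrt ((theta k)^4 + 4 * (theta k)\<^sup>2) - (theta k)\<^sup>2) / 2"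

text \<open>The ceiling is never negative for \<open>\<mu> > 0\<close>, so \<open>nat\<close> loses nothing. It is \<open>0\<close>
  exactly when \<open>\<mu> \<ge> 4 e\<close>, and then it is not admissible as a restarting period.\<close>

definition restart_period :: "real \<Rightarrow> nat" where
  "restart_period mu = nat \<lceil>2 * sqrt (exp 1 / mu) - 1\<rceil>"

text \<open>The iterates carry the pair \<open>(x\<^sub>k, z\<^sub>k)\<close>. The proximal step of FISTA at \<open>y\<^sub>k\<close> is
  the same minimization problem as the one that defines \<open>prox_grad\<close> at \<open>y\<^sub>k\<close>.\<close>

primrec fista_iter ::
    "(real^'n \<Rightarrow> real) \<Rightarrow> (real^'n \<Rightarrow> ereal) \<Rightarrow> real^'n \<Rightarrow> real^'n \<Rightarrow> nat
      \<Rightarrow> (real^'n) \<times> (real^'n)" where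
  "fista_iter f psi L x0 0 = (x0, x0)"
| "fista_iter f psi L x0 (Suc k) =
     (let (x, z) = fista_iter f psi L x0 k;
          y = (1 - theta k) *\<^sub>R x + theta k *\<^sub>R z;
          x' = prox_grad f psi L y
      in (x', z + (1 / theta k) *\<^sub>R (x' - y)))"

definition fista ::
    "(real^'n \<Rightarrow> real) \<Rightarrow> (real^'n \<Rightarrow> ereal) \<Rightarrow> real^'n \<Rightarrow> real^'n \<Rightarrow> nat \<Rightarrow> real^'n" where
  "fista f psi L x0 K = fst (fista_iter f psi L x0 K)"

primrec apg_iter ::
    "(real^'n \<Rightarrow> real) \<Rightarrow> (real^'n \<Rightarrow> ereal) \<Rightarrow> real^'n \<Rightarrow> real^'n \<Rightarrow> nat
      \<Rightarrow> (real^'n) \<times> (real^'n)" where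
  "apg_iter f psi L x0 0 = (x0, x0)"
| "apg_iter f psi L x0 (Suc k) =
     (let (x, z) = apg_iter f psi L x0 k;
          y = (1 - theta k) *\<^sub>R x + theta k *\<^sub>R z;
          z' = (ARG_MIN (\<lambda>w. ereal (gradient f y \<bullet> (w - y) + theta k / 2 * (wnorm L (w - z))\<^sup>2)
                              + psi w) w. True)
      in (y + theta k *\<^sub>R (z' - z), z'))"

definition apg ::
    "(real^'n \<Rightarrow> real) \<Rightarrow> (real^'n \<Rightarrow> ereal) \<Rightarrow> real^'n \<Rightarrow> real^'n \<Rightarrow> nat \<Rightarrow> real^'n" where
  "apg f psi L x0 K = fst (apg_iter f psi L x0 K)"


section \<open>Adaptive restart\<close>

text \<open>The trace of a run is given by the iterates \<open>x s t\<close> and the stage lengths \<open>t\<^sub>s = T s\<close>.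
  The stage estimates are \<open>\<mu>\<^sub>s = \<mu>\<^sub>0 / 2\<^sup>s\<close>. The point from which the start of stage \<open>s\<close>
  was computed is \<open>x\<^sub>s\<^sub>-\<^sub>1\<close> at its last index, with the convention that it is the initial
  point \<open>x0\<close> when \<open>s = 0\<close>.\<close>

definition stage_mu :: "real \<Rightarrow> nat \<Rightarrow> real" where
  "stage_mu mu0 s = mu0 / 2 ^ s"

definition prev_point ::
    "real^'n \<Rightarrow> (nat \<Rightarrow> nat \<Rightarrow> real^'n) \<Rightarrow> (nat \<Rightarrow> nat) \<Rightarrow> nat \<Rightarrow> real^'n" where
  "prev_point x0 x T s = (case s of 0 \<Rightarrow> x0 | Suc r \<Rightarrow> x r (T r))"

definition stage_const ::
    "real^'n \<Rightarrow> real \<Rightarrow> real^'n \<Rightarrow> (nat \<Rightarrow> nat \<Rightarrow> real^'n) \<Rightarrow> (nat \<Rightarrow> nat) \<Rightarrow> nat \<Rightarrow> real" where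
  "stage_const L mu0 x0 x T s =
     16 * (wnorm L (x s 0 - prev_point x0 x T s))\<^sup>2 / stage_mu mu0 s"

definition stage_exit ::
    "(real^'n \<Rightarrow> real) \<Rightarrow> (real^'n \<Rightarrow> ereal) \<Rightarrow> real^'n \<Rightarrow> real \<Rightarrow> real
      \<Rightarrow> real^'n \<Rightarrow> (nat \<Rightarrow> nat \<Rightarrow> real^'n) \<Rightarrow> (nat \<Rightarrow> nat) \<Rightarrow> nat \<Rightarrow> nat \<Rightarrow> bool" where
  "stage_exit f psi L eps mu0 x0 x T s t \<longleftrightarrow>
     (wnorm L (prox_grad f psi L (x s t) - x s t))\<^sup>2
       > stage_const L mu0 x0 x T s
         * ((theta (restart_period (stage_mu mu0 s) - 1))\<^sup>2 / stage_mu mu0 s) ^ t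
     \<or> (wnorm L (prox_grad f psi L (x s t) - x s t))\<^sup>2 \<le> eps"

text \<open>\<open>adares_run f psi L eps mu0 use_fista x0 xhat shat Nhat\<close> says that the algorithm, started
  at \<open>x0\<close>, stops and returns \<open>xhat\<close>, \<open>shat\<close>, \<open>Nhat\<close>. The free choice between the two inner
  methods is resolved by the oracle \<open>use_fista\<close>, which may decide differently at each pass
  \<open>t\<close> of each stage \<open>s\<close>; once it is fixed, the algorithm is deterministic. Exit from a stage
  is tested after each pass only, whence \<open>1 \<le> T s\<close>.\<close>

definition adares_run ::
    "(real^'n \<Rightarrow> real) \<Rightarrow> (real^'n \<Rightarrow> ereal) \<Rightarrow> real^'n \<Rightarrow> real \<Rightarrow> real
      \<Rightarrow> (nat \<Rightarrow> nat \<Rightarrow> bool) \<Rightarrow> real^'n \<Rightarrow> real^'n \<Rightarrow> nat \<Rightarrow> nat \<Rightarrow> bool" where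
  "adares_run f psi L eps mu0 use_fista x0 xhat shat Nhat \<longleftrightarrow>
     (\<exists>x T.
        x 0 0 = prox_grad f psi L x0 \<and>
        (\<forall>s\<le>shat.
           (\<forall>t<T s. x s (Suc t) =
              (if use_fista s t then fista f psi L (x s t) (restart_period (stage_mu mu0 s))
               else apg f psi L (x s t) (restart_period (stage_mu mu0 s)))) \<and>
           1 \<le> T s \<and>
           stage_exit f psi L eps mu0 x0 x T s (T s) \<and>
           (\<forall>t. 1 \<le> t \<and> t < T s \<longrightarrow> \<not> stage_exit f psi L eps mu0 x0 x T s t) \<and>
           x (Suc s) 0 = prox_grad f psi L (x s (T s)) \<and>
           ((wnorm L (x (Suc s) 0 - x s (T s)))\<^sup>2 \<le> eps \<longleftrightarrow> s = shat)) \<and>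
        xhat = prox_grad f psi L (x shat (T shat)) \<and>
        Nhat = 1 + (\<Sum>s\<le>shat. (T s * restart_period (stage_mu mu0 s) + 1)))"

end

theory Submission
  imports Defs
begin

text \<open>
  FISTA and APG satisfy the same one-step inequality, which telescopes to
  \<open>F(x\<^sub>K) - F(u) \<le> \<theta>\<^sub>K\<^sub>-\<^sub>1\<^sup>2/2 \<parallel>x\<^sub>0 - u\<parallel>\<^sub>L\<^sup>2\<close> for every \<open>u\<close> in the domain. Hence every pass
  decreases \<open>F\<close>, and once \<open>\<mu>\<^sub>s \<le> \<mu>\<^sub>F\<close> the error bound makes a pass contract the gap by
  \<open>\<theta>\<^sup>2/\<mu>\<^sub>s \<le> 1/e\<close>. Because also \<open>gap (T x) \<le> (8/\<mu>\<^sub>F) \<parallel>T x - x\<parallel>\<^sub>L\<^sup>2\<close> and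
  \<open>\<parallel>T x - x\<parallel>\<^sub>L\<^sup>2 \<le> 2 gap x\<close>, such a stage can only be left by the \<open>\<epsilon>\<close>-test, which ends the
  run; so \<open>s\<close> never exceeds \<open>\<lceil>log\<^sub>2 (\<mu>\<^sub>0/\<mu>\<^sub>F)\<rceil>\<close>. A stage lasts only while
  \<open>\<epsilon> < C\<^sub>s e\<^sup>-\<^sup>t\<close>, and the periods \<open>K\<^sub>s \<le> 2 sqrt (e/\<mu>\<^sub>s)\<close> sum geometrically. The \<open>-1\<close> in the
  definition of the last period pays for the count of the last stage in the second bound.
\<close>

section \<open>The weighted norm\<close>

text \<open>This linear map carries the weighted norm to the Euclidean one, so polarization and
  Cauchy-Schwarz for \<open>wnorm\<close> reduce to the ordinary inner product.\<close>

definition wscale :: "real^'n \<Rightarrow> real^'n \<Rightarrow> real^'n" where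
  "wscale v x = (\<chi> i. sqrt (v $ i) * x $ i)"

lemma linear_wscale: "linear (wscale v)"
  by (rule linearI) (simp_all add: wscale_def vec_eq_iff algebra_simps)

lemmas wscale_simps =
  linear_add[OF linear_wscale] linear_diff[OF linear_wscale] linear_scale[OF linear_wscale]

lemma wnorm_eq_norm:
  assumes "\<forall>i. 0 < v $ i"
  shows "wnorm v x = norm (wscale v x)"
proof -
  have "(sqrt (v $ i) * x $ i)\<^sup>2 = v $ i * (x $ i)\<^sup>2" for i
    using assms by (simp add: power_mult_distrib less_imp_le)
  then show ?thesis
    by (simp add: wnorm_def wscale_def norm_vec_def L2_set_def)
qed

lemma wnorm_power2:
  assumes "\<forall>i. 0 < v $ i"
  shows "(wnorm v x)\<^sup>2 = wscale v x \<bullet> wscale v x"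
  by (simp add: wnorm_eq_norm[OF assms] power2_norm_eq_inner)

lemma wnorm_minus_commute: "wnorm v (x - y) = wnorm v (y - x)"
  by (simp add: wnorm_def power2_commute)

text \<open>The smallest weight serves as the constant. Coercivity makes the sublevel sets of the
  proximal subproblems bounded.\<close>

lemma wnorm_coercive:
  fixes v :: "real^'n"
  assumes "\<forall>i. 0 < v $ i"
  obtains l where "0 < l" "\<And>x. l * (norm x)\<^sup>2 \<le> (wnorm v x)\<^sup>2"
proof
  let ?l = "Min (range (($) v))"
  show "0 < ?l"
    using assms by (subst Min_gr_iff) auto
  fix x :: "real^'n"
  have "?l * (norm x)\<^sup>2 = (\<Sum>i\<in>UNIV. ?l * (x $ i)\<^sup>2)"
    by (simp add: norm_vec_def L2_set_def sum_nonneg sum_distrib_left)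
  also have "\<dots> \<le> (\<Sum>i\<in>UNIV. v $ i * (x $ i)\<^sup>2)"
    by (intro sum_mono mult_right_mono) auto
  also have "\<dots> = (wnorm v x)\<^sup>2"
    unfolding wnorm_def by (subst real_sqrt_pow2) (auto intro!: sum_nonneg mult_nonneg_nonneg simp: assms less_imp_le)
  finally show "?l * (norm x)\<^sup>2 \<le> (wnorm v x)\<^sup>2" .
qed

lemma wnorm_zero [simp]: "wnorm v 0 = 0"
  by (simp add: wnorm_def)

lemma wnorm_eq_0_iff:
  assumes "\<forall>i. 0 < v $ i"
  shows "wnorm v x = 0 \<longleftrightarrow> x = 0"
  using assms by (simp add: wnorm_eq_norm wscale_def vec_eq_iff) (metis less_irrefl)

lemma le_wdist:
  assumes "S \<noteq> {}" "\<And>y. y \<in> S \<Longrightarrow> c \<le> wnorm v (x - y)"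
  shows "c \<le> wdist v x S"
  unfolding wdist_def using assms by (rule cINF_greatest)

section \<open>Gradients\<close>

text \<open>The adjoint of the derivative, applied to 1, represents it as an inner product;
  uniqueness of derivatives then resolves the definite description in
  \<open>gradient\<close>.\<close>

lemma GDERIV_gradient:
  fixes f :: "real^'n \<Rightarrow> real"
  assumes "f differentiable (at x)"
  shows "GDERIV f x :> gradient f x"
proof -
  obtain D where D: "(f has_derivative D) (at x)"
    using assms unfolding differentiable_def by blast
  have "linear D"
    using D has_derivative_linear by blast
  then have "D = (\<lambda>h. h \<bullet> adjoint D 1)"
    by (simp add: adjoint_works fun_eq_iff)
  then have ex: "GDERIV f x :> adjoint D 1"
    using D unfolding gderiv_def by simp
  have "g = g'" if "GDERIV f x :> g" "GDERIV f x :> g'" for g g'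
  proof -
    have "(\<lambda>h. h \<bullet> g) = (\<lambda>h. h \<bullet> g')"
      using that unfolding gderiv_def by (rule has_derivative_unique)
    then show ?thesis
      by (metis vector_eq_ldot)
  qed
  then show ?thesis
    unfolding gradient_def using ex by (metis theI)
qed

text \<open>The directional derivative is the limit of the difference quotients from the right. This
  serves both the tangent inequality for f and, applied to -f, the affine minorant of
  \<open>p\<close>.\<close>

lemma GDERIV_le_slope:
  assumes f: "GDERIV f x :> g"
    and le: "\<And>t. 0 < t \<Longrightarrow> t < 1 \<Longrightarrow> f (x + t *\<^sub>R d) - f x \<le> t * c"
  shows "g \<bullet> d \<le> c"
proof -
  let ?h = "\<lambda>t::real. x + t *\<^sub>R d"
  have "(?h has_derivative (\<lambda>t. t *\<^sub>R d)) (at 0)"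
    by (auto intro!: derivative_eq_intros)
  moreover have "(f has_derivative (\<lambda>h. h \<bullet> g)) (at (?h 0))"
    using f by (simp add: gderiv_def)
  ultimately have "((\<lambda>t. f (?h t)) has_derivative (\<lambda>t. (t *\<^sub>R d) \<bullet> g)) (at 0)"
    using has_derivative_compose[of ?h "\<lambda>t. t *\<^sub>R d" 0 UNIV f "\<lambda>h. h \<bullet> g"] by blast
  then have "((\<lambda>t. f (?h t)) has_real_derivative (g \<bullet> d)) (at 0)"
    unfolding has_field_derivative_def by (rule has_derivative_eq_rhs) (simp add: fun_eq_iff inner_commute)
  then have "((\<lambda>t. (f (?h t) - f x) / t) \<longlongrightarrow> g \<bullet> d) (at_right 0)"
    unfolding DERIV_def by (simp add: filterlim_at_split)
  moreover have "\<forall>\<^sub>F t in at_right 0. (f (?h t) - f x) / t \<le> c"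
    unfolding eventually_at_right_field using le by (intro exI[of _ 1]) (auto simp: field_simps)
  ultimately show ?thesis
    by (rule tendsto_upperbound) simp
qed

lemma convex_on_above_tangent:
  fixes f :: "real^'n \<Rightarrow> real"
  assumes "convex_on UNIV f" "f differentiable (at x)"
  shows "f x + gradient f x \<bullet> (y - x) \<le> f y"
proof -
  have "f (x + t *\<^sub>R (y - x)) - f x \<le> t * (f y - f x)" if "0 < t" "t < 1" for t
    using convex_onD[OF assms(1), of t x y] that by (simp add: algebra_simps)
  from GDERIV_le_slope[OF GDERIV_gradient[OF assms(2)] this] show ?thesis
    by simp
qed

section \<open>The step sizes and restarting periods\<close>

text \<open>With a = \<open>theta k\<close>, the next value is the positive root b of b^2 = (1 - b)
  a^2. Positivity of a is needed for that, so it is carried through the induction.\<close>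

lemma theta_props: "0 < theta k \<and> theta k \<le> 1 \<and> (theta (Suc k))\<^sup>2 = (1 - theta (Suc k)) * (theta k)\<^sup>2"
proof -
  have step: "0 < theta (Suc k)" "theta (Suc k) \<le> 1"
    "(theta (Suc k))\<^sup>2 = (1 - theta (Suc k)) * (theta k)\<^sup>2" if a: "0 < theta k" for k
  proof -
    let ?a = "theta k"
    let ?r = "sqrt (?a ^ 4 + 4 * ?a\<^sup>2)"
    have r: "?r\<^sup>2 = ?a ^ 4 + 4 * ?a\<^sup>2"
      by (simp add: add_nonneg_nonneg)
    have pos: "0 < ?a\<^sup>2"
      using a by simp
    have "(?a\<^sup>2)\<^sup>2 < ?r\<^sup>2"
      unfolding r using pos by (simp add: power_mult[symmetric])
    then have lt: "?a\<^sup>2 < ?r"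
      by (rule power_less_imp_less_base) simp
    have "?r\<^sup>2 \<le> (?a\<^sup>2 + 2)\<^sup>2"
      unfolding r by (simp add: power2_sum power_mult[symmetric])
    then have le: "?r \<le> ?a\<^sup>2 + 2"
      by (rule power2_le_imp_le) simp
    show "0 < theta (Suc k)" "theta (Suc k) \<le> 1"
      using lt le by simp_all
    show "(theta (Suc k))\<^sup>2 = (1 - theta (Suc k)) * ?a\<^sup>2"
      using r by (simp add: power2_eq_square power4_eq_xxxx field_simps)
  qed
  have "0 < theta k \<and> theta k \<le> 1"
    by (induction k) (use step in auto)
  then show ?thesis
    using step by blast
qed

lemma theta_pos: "0 < theta k" and theta_le_1: "theta k \<le> 1"
  and theta_Suc: "(theta (Suc k))\<^sup>2 = (1 - theta (Suc k)) * (theta k)\<^sup>2"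
  using theta_props by blast+

text \<open>For the reciprocals a, b of consecutive values the recursion reads b^2 - b = a^2.
  Completing the square gives b \<ge> a + 1/2, hence linear growth.\<close>

lemma theta_le: "theta k \<le> 2 / (real k + 2)"
proof -
  have "(real k + 2) / 2 \<le> 1 / theta k"
  proof (induction k)
    case (Suc k)
    let ?a = "1 / theta k" and ?b = "1 / theta (Suc k)"
    have nz: "theta k \<noteq> 0" "theta (Suc k) \<noteq> 0"
      using theta_pos less_irrefl by metis+
    have "?b\<^sup>2 - ?b = ?a\<^sup>2"
      using theta_Suc[of k] nz by (simp add: field_simps power2_eq_square del: theta.simps)
    then have "?a\<^sup>2 \<le> (?b - 1/2)\<^sup>2"
      by (simp add: power2_diff del: theta.simps) (simp add: power2_eq_square)
    moreover have "1 \<le> ?b"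
      using theta_le_1[of "Suc k"] theta_pos[of "Suc k"] by (simp del: theta.simps)
    ultimately have "?a \<le> ?b - 1/2"
      by (intro power2_le_imp_le[of ?a "?b - 1/2"]) linarith+
    then show ?case
      using Suc by (simp add: field_simps del: theta.simps)
  qed simp
  then show ?thesis
    using theta_pos[of k] by (simp add: field_simps)
qed

declare theta.simps(2) [simp del]

lemma restart_period_ge: "2 * sqrt (exp 1 / mu) - 1 \<le> real (restart_period mu)"
  unfolding restart_period_def by linarith

text \<open>The ceiling adds less than 1, which the -1 absorbs; positivity of the bound covers the
  truncation by \<open>nat\<close>.\<close>

lemma restart_period_le:
  assumes "0 < mu"
  shows "real (restart_period mu) \<le> 2 * sqrt (exp 1 / mu)"
proof -
  have "0 < 2 * sqrt (exp 1 / mu)"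
    using assms by simp
  then show ?thesis
    unfolding restart_period_def by linarith
qed

lemma restart_period_antimono:
  assumes "0 < mu" "mu \<le> nu"
  shows "restart_period nu \<le> restart_period mu"
proof -
  have "exp 1 / nu \<le> exp 1 / mu"
    using assms by (intro divide_left_mono) auto
  then have "2 * sqrt (exp 1 / nu) - 1 \<le> 2 * sqrt (exp 1 / mu) - 1"
    by simp
  then show ?thesis
    unfolding restart_period_def by (intro nat_mono ceiling_mono)
qed

text \<open>At index K - 1 the bound \<open>theta_le\<close> has denominator K + 1, and K + 1 is at
  least 2 sqrt(e/mu) by the choice of the period.\<close>

lemma theta_restart_period:
  assumes "0 < mu" "1 \<le> restart_period mu"
  shows "(theta (restart_period mu - 1))\<^sup>2 / mu \<le> exp (-1)"
proof -
  let ?K = "restart_period mu"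
  let ?s = "sqrt (exp 1 / mu)"
  have s: "0 < ?s"
    using assms by simp
  have "theta (?K - 1) \<le> 2 / (real ?K + 1)"
    using theta_le[of "?K - 1"] assms(2) by (simp add: of_nat_diff add_ac)
  also have "\<dots> \<le> 2 / (2 * ?s)"
    using restart_period_ge[of mu] s by (intro divide_left_mono) auto
  finally have "theta (?K - 1) \<le> 1 / ?s"
    by simp
  then have "(theta (?K - 1))\<^sup>2 \<le> (1 / ?s)\<^sup>2"
    using theta_pos by (intro power_mono) (auto intro: less_imp_le)
  also have "\<dots> = mu * exp (-1)"
    using assms(1) by (simp add: power_divide exp_minus divide_simps)
  finally show ?thesis
    using assms(1) by (simp add: field_simps)
qed

text \<open>A nonzero period forces mu < 4e, and 16 is a convenient larger number: below it, 32/mu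
  exceeds 2, which \<open>slow_stage_length\<close> uses for stages of a single pass.\<close>

lemma restart_period_pos_imp_less:
  assumes "0 < mu" "1 \<le> restart_period mu"
  shows "mu < 16"
proof (rule ccontr)
  assume "\<not> mu < 16"
  then have "exp 1 / mu \<le> (1/2)\<^sup>2"
    using exp_le by (simp add: power2_eq_square field_simps)
  then have "sqrt (exp 1 / mu) \<le> 1/2"
    using real_sqrt_le_iff[of "exp 1 / mu" "(1/2)\<^sup>2"] by simp
  then show False
    using assms(2) unfolding restart_period_def by linarith
qed

section \<open>Composite convex objectives\<close>

locale composite =
  fixes f :: "real^'n \<Rightarrow> real" and psi :: "real^'n \<Rightarrow> ereal" and L :: "real^'n"
  assumes f_convex: "convex_on UNIV f"
    and f_differentiable: "\<And>x. f differentiable (at x)"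
    and psi_proper: "proper_fun psi"
    and psi_closed: "closed_fun psi"
    and psi_convex: "convex_fun psi"
    and minimizers_nonempty: "minimizers (objective f psi) \<noteq> {}"
    and L_pos: "\<forall>i. 0 < L $ i"
    and smoothness: "smooth_wrt f L"
begin

section \<open>Real-valued form of the objective on its effective domain\<close>

abbreviation "N \<equiv> wnorm L"
abbreviation "D \<equiv> eff_dom psi"
abbreviation "prox \<equiv> prox_grad f psi L"
abbreviation "sol \<equiv> minimizers (objective f psi)"

text \<open>Since \<open>real_of_ereal\<close> sends infinity to 0, \<open>p\<close> and
  \<open>F\<close> represent the extended-valued functions on \<open>D\<close> only.\<close>

definition p :: "real^'n \<Rightarrow> real" where "p x = real_of_ereal (psi x)"
definition F :: "real^'n \<Rightarrow> real" where "F x = f x + p x"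

lemma psi_eq: "psi x = (if x \<in> D then ereal (p x) else \<infinity>)"
  using psi_proper by (cases "psi x") (auto simp: p_def eff_dom_def proper_fun_def)

lemma objective_eq: "objective f psi x = (if x \<in> D then ereal (F x) else \<infinity>)"
  unfolding objective_def by (subst psi_eq) (simp add: F_def)

lemma eff_dom_objective: "eff_dom (objective f psi) = D"
  unfolding eff_dom_def[of "objective f psi"] objective_eq by auto

lemma convex_combination:
  assumes "x \<in> D" "y \<in> D" "0 \<le> t" "t \<le> 1"
  shows "(1 - t) *\<^sub>R x + t *\<^sub>R y \<in> D"
    and "p ((1 - t) *\<^sub>R x + t *\<^sub>R y) \<le> (1 - t) * p x + t * p y"
proof -
  have "(x, p x) \<in> epi psi" "(y, p y) \<in> epi psi"
    using assms psi_eq by (auto simp: epi_def)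
  then have "(1 - t) *\<^sub>R (x, p x) + t *\<^sub>R (y, p y) \<in> epi psi"
    using psi_convex assms unfolding convex_fun_def by (intro convexD) auto
  then have *: "psi ((1 - t) *\<^sub>R x + t *\<^sub>R y) \<le> ereal ((1 - t) * p x + t * p y)"
    by (simp add: epi_def)
  then show "(1 - t) *\<^sub>R x + t *\<^sub>R y \<in> D"
    using psi_eq[of "(1 - t) *\<^sub>R x + t *\<^sub>R y"] by (auto split: if_splits)
  with * show "p ((1 - t) *\<^sub>R x + t *\<^sub>R y) \<le> (1 - t) * p x + t * p y"
    by (subst (asm) psi_eq) simp
qed

lemma f_upper: "f x \<le> f y + gradient f y \<bullet> (x - y) + (N (x - y))\<^sup>2 / 2"
  using smoothness unfolding smooth_wrt_def by simp

lemma f_lower: "f y + gradient f y \<bullet> (x - y) \<le> f x"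
  by (rule convex_on_above_tangent[OF f_convex f_differentiable])

lemma F_convex:
  assumes "x \<in> D" "y \<in> D" "0 \<le> t" "t \<le> 1"
  shows "F ((1 - t) *\<^sub>R x + t *\<^sub>R y) \<le> (1 - t) * F x + t * F y"
  using convex_combination(2)[OF assms] convex_onD[OF f_convex, of t x y] assms
  by (simp add: F_def algebra_simps)

lemma sol_iff: "u \<in> sol \<longleftrightarrow> u \<in> D \<and> (\<forall>x\<in>D. F u \<le> F x)"
proof
  \<comment> \<open>A point of finite value excludes minimizers at which the objective is
    infinite.\<close>
  obtain v where "v \<in> D"
    using psi_proper by (auto simp: proper_fun_def eff_dom_def)
  moreover assume "u \<in> sol"
  then have *: "objective f psi u \<le> objective f psi x" for x
    by (simp add: minimizers_def)
  ultimately have "u \<in> D"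
    using *[of v] by (auto simp: objective_eq split: if_splits)
  then show "u \<in> D \<and> (\<forall>x\<in>D. F u \<le> F x)"
    using * by (auto simp: objective_eq split: if_splits) (metis ereal_less_eq(3))
next
  assume "u \<in> D \<and> (\<forall>x\<in>D. F u \<le> F x)"
  then show "u \<in> sol"
    by (auto simp: minimizers_def objective_eq)
qed

lemma min_value_eq:
  assumes "u \<in> sol"
  shows "min_value (objective f psi) = ereal (F u)"
proof -
  have "min_value (objective f psi) = objective f psi u"
    unfolding min_value_def using assms
    by (intro antisym INF_lower2[of u] INF_greatest) (auto simp: minimizers_def)
  then show ?thesis
    using assms sol_iff by (simp add: objective_eq)
qed

abbreviation "gapF \<equiv> gap (objective f psi)"

lemma gap_eq:
  assumes "x \<in> D" "u \<in> sol"
  shows "gapF x = F x - F u"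
  unfolding gap_def min_value_eq[OF assms(2)] using assms(1) by (simp add: objective_eq)

lemma gap_nonneg: "0 \<le> gapF x" if "x \<in> D"
  using that minimizers_nonempty gap_eq sol_iff by fastforce

lemma gap_diff: "gapF x - gapF y = F x - F y" if "x \<in> D" "y \<in> D"
  using that minimizers_nonempty gap_eq by fastforce

text \<open>At a minimizer of \<open>f + p\<close> the negative gradient of \<open>f\<close> is a subgradient of \<open>p\<close>, so no
  separation theorem is needed for an affine minorant of \<open>p\<close>.\<close>

lemma affine_minorant:
  obtains a b where "\<And>x. x \<in> D \<Longrightarrow> b + a \<bullet> x \<le> p x"
proof -
  obtain u where u: "u \<in> sol"
    using minimizers_nonempty by blast
  then have uD: "u \<in> D"
    using sol_iff by blast
  have "p u - gradient f u \<bullet> (x - u) \<le> p x" if x: "x \<in> D" for x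
  proof -
    have "GDERIV (\<lambda>x. - f x) u :> - gradient f u"
      using GDERIV_minus GDERIV_gradient[OF f_differentiable] by blast
    moreover have "- f (u + t *\<^sub>R (x - u)) - - f u \<le> t * (p x - p u)" if "0 < t" "t < 1" for t
    proof -
      have eq: "(1 - t) *\<^sub>R u + t *\<^sub>R x = u + t *\<^sub>R (x - u)"
        by (simp add: algebra_simps)
      have "F u \<le> F (u + t *\<^sub>R (x - u))"
        using convex_combination(1)[OF uD x, of t] that u sol_iff unfolding eq by simp
      moreover have "p (u + t *\<^sub>R (x - u)) \<le> (1 - t) * p u + t * p x"
        using convex_combination(2)[OF uD x, of t] that unfolding eq by simp
      ultimately show ?thesis
        by (simp add: F_def algebra_simps)
    qed
    ultimately have "- gradient f u \<bullet> (x - u) \<le> p x - p u"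
      by (rule GDERIV_le_slope)
    then show ?thesis
      by simp
  qed
  then have "(p u + gradient f u \<bullet> u) + (- gradient f u) \<bullet> x \<le> p x" if "x \<in> D" for x
    using that by (simp add: inner_diff_right algebra_simps)
  then show ?thesis
    using that by blast
qed

section \<open>Existence of minimizers of the proximal subproblems, and their three-point
  inequality\<close>

lemma bounded_quadratic_sublevel:
  fixes g z :: "real^'n"
  assumes "0 < c"
  shows "bounded {w. b + g \<bullet> w + c / 2 * (N (w - z))\<^sup>2 \<le> m}"
proof -
  obtain l where l: "0 < l" "\<And>x. l * (norm x)\<^sup>2 \<le> (N x)\<^sup>2"
    using wnorm_coercive[OF L_pos] by blast
  let ?e = "c / 2 * l" and ?M = "\<bar>m\<bar> + \<bar>b\<bar> + \<bar>g \<bullet> z\<bar>"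
  have e: "0 < ?e"
    using assms l(1) by simp
  have "norm (w - z) \<le> 1 + (norm g + ?M) / ?e"
    if w: "b + g \<bullet> w + c / 2 * (N (w - z))\<^sup>2 \<le> m" for w
  proof (cases "norm (w - z) \<le> 1")
    case True
    moreover have "0 \<le> (norm g + ?M) / ?e"
      using e by simp
    ultimately show ?thesis
      by linarith
  next
    case False
    let ?n = "norm (w - z)"
    have "c / 2 * (l * ?n\<^sup>2) \<le> c / 2 * (N (w - z))\<^sup>2"
      using l(2) assms by (intro mult_left_mono) auto
    moreover have "- (norm g * ?n) \<le> g \<bullet> (w - z)"
      using Cauchy_Schwarz_ineq2[of g "w - z"] by linarith
    ultimately have "?e * ?n\<^sup>2 \<le> norm g * ?n + ?M"
      using w by (simp add: inner_diff_right)
    \<comment> \<open>Because the norm exceeds 1 here, the constant can be absorbed into a linear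
      term; dividing by the norm then bounds it.\<close>
    also have "\<dots> \<le> norm g * ?n + ?M * ?n"
      using False by (intro add_left_mono) (simp add: mult_le_cancel_left1)
    finally have "(?e * ?n) * ?n \<le> (norm g + ?M) * ?n"
      by (simp add: power2_eq_square algebra_simps)
    then have "?e * ?n \<le> norm g + ?M"
      by (rule mult_right_le_imp_le) (use False in linarith)
    then have "?n \<le> (norm g + ?M) / ?e"
      using e by (simp only: pos_le_divide_eq mult.commute)
    then show ?thesis
      by simp
  qed
  then have "{w. b + g \<bullet> w + c / 2 * (N (w - z))\<^sup>2 \<le> m} \<subseteq> cball z (1 + (norm g + ?M) / ?e)"
    by (auto simp: dist_norm norm_minus_commute)
  then show ?thesis
    using bounded_cball bounded_subset by blast
qed

lemma continuous_N: "continuous_on S (\<lambda>w. (N (h w))\<^sup>2)" if "continuous_on S h"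
proof -
  have "continuous_on UNIV (wscale L)"
    using linear_wscale linear_continuous_on linear_conv_bounded_linear by blast
  then have "continuous_on S (\<lambda>w. wscale L (h w))"
    using that by (rule continuous_on_compose2) auto
  then show ?thesis
    unfolding wnorm_power2[OF L_pos] by (intro continuous_on_inner)
qed

text \<open>Minimization takes place over the epigraph: there the objective \<open>G\<close> is
  continuous and the feasible set closed, although \<open>p\<close> itself need not be continuous.
  Compactness of a sublevel set gives the minimizer.\<close>

lemma prox_problem_attained:
  assumes "0 < c"
  obtains w where "w \<in> D"
    "\<And>v. v \<in> D \<Longrightarrow> g \<bullet> w + c / 2 * (N (w - z))\<^sup>2 + p w \<le> g \<bullet> v + c / 2 * (N (v - z))\<^sup>2 + p v"
proof -
  define G where "G = (\<lambda>(w, r). g \<bullet> w + c / 2 * (N (w - z))\<^sup>2 + r)"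
  obtain a b where ab: "\<And>x. x \<in> D \<Longrightarrow> b + a \<bullet> x \<le> p x"
    using affine_minorant by blast
  obtain v0 where v0: "v0 \<in> D"
    using psi_proper by (auto simp: proper_fun_def eff_dom_def)
  let ?m = "G (v0, p v0)"
  let ?S = "epi psi \<inter> {q. G q \<le> ?m}"
  have epi_iff: "(w, r) \<in> epi psi \<longleftrightarrow> w \<in> D \<and> p w \<le> r" for w r
    unfolding epi_def using psi_eq[of w] by auto
  have cont: "continuous_on UNIV G"
    unfolding G_def case_prod_unfold by (intro continuous_intros continuous_N)
  have "bounded ?S"
  proof -
    \<comment> \<open>Replacing the height r by the affine minorant of \<open>p\<close> puts w into
      a sublevel set of a quadratic with linear coefficient g + a. Then r is bounded below by the
      minorant and above by dropping the quadratic term.\<close>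
    let ?W = "{w. b + (g + a) \<bullet> w + c / 2 * (N (w - z))\<^sup>2 \<le> ?m}"
    have bW: "bounded ?W"
      by (rule bounded_quadratic_sublevel[OF assms])
    then obtain R where R: "\<And>w. w \<in> ?W \<Longrightarrow> norm w \<le> R"
      unfolding bounded_iff by blast
    have "(w, r) \<in> ?W \<times> {b - norm a * R..?m + norm g * R}" if "(w, r) \<in> ?S" for w r
    proof -
      have r: "b + a \<bullet> w \<le> r" and G: "g \<bullet> w + c / 2 * (N (w - z))\<^sup>2 + r \<le> ?m"
        using that ab[of w] by (auto simp: epi_iff G_def)
      then have w: "w \<in> ?W"
        by (auto simp: inner_add_left)
      have *: "- (norm h * R) \<le> h \<bullet> w" for h
        using Cauchy_Schwarz_ineq2[of h w] mult_left_mono[OF R[OF w], of "norm h"] by auto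
      have "0 \<le> c / 2 * (N (w - z))\<^sup>2"
        using assms by simp
      then show ?thesis
        using w r G *[of a] *[of g] by auto
    qed
    then have "?S \<subseteq> ?W \<times> {b - norm a * R..?m + norm g * R}"
      by (rule subrelI)
    then show ?thesis
      using bounded_Times[OF bW bounded_closed_interval] bounded_subset by blast
  qed
  moreover have "closed ?S"
    using psi_closed cont unfolding closed_fun_def
    by (intro closed_Int closed_Collect_le continuous_on_const) auto
  ultimately have "compact ?S"
    by (simp add: compact_eq_bounded_closed)
  moreover have "(v0, p v0) \<in> ?S"
    using v0 by (simp add: epi_iff)
  moreover have "continuous_on ?S G"
    using cont by (rule continuous_on_subset) simp
  ultimately have "\<exists>q\<in>?S. \<forall>q'\<in>?S. G q \<le> G q'"
    by (intro continuous_attains_inf) blast+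
  then obtain w r where wr: "(w, r) \<in> ?S" "\<And>q. q \<in> ?S \<Longrightarrow> G (w, r) \<le> G q"
    by (metis surj_pair)
  show ?thesis
  proof
    show "w \<in> D"
      using wr(1) by (simp add: epi_iff)
    fix v assume v: "v \<in> D"
    have "G (w, r) \<le> G (v, p v)"
    proof (cases "G (v, p v) \<le> ?m")
      case True
      then show ?thesis
        using wr(2) v by (simp add: epi_iff)
    next
      case False
      then show ?thesis
        using wr(1) by simp
    qed
    moreover have "p w \<le> r"
      using wr(1) by (simp add: epi_iff)
    ultimately show "g \<bullet> w + c / 2 * (N (w - z))\<^sup>2 + p w \<le> g \<bullet> v + c / 2 * (N (v - z))\<^sup>2 + p v"
      by (simp add: G_def)
  qed
qed

text \<open>The quadratic term gains \<open>c / 2 * t * (1 - t) * (N (v - w))\<^sup>2\<close> on the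
  segment from w to v. Comparing the minimizer w with a point of the segment, dividing by t and
  letting t tend to 0 yields the extra term.\<close>

lemma three_point:
  assumes w: "w \<in> D" and v: "v \<in> D"
    and min: "\<And>v. v \<in> D \<Longrightarrow>
      g \<bullet> w + c / 2 * (N (w - z))\<^sup>2 + p w \<le> g \<bullet> v + c / 2 * (N (v - z))\<^sup>2 + p v"
  shows "g \<bullet> w + c / 2 * (N (w - z))\<^sup>2 + p w + c / 2 * (N (v - w))\<^sup>2
    \<le> g \<bullet> v + c / 2 * (N (v - z))\<^sup>2 + p v"
proof -
  let ?h = "\<lambda>v. g \<bullet> v + c / 2 * (N (v - z))\<^sup>2 + p v"
  have ineq: "c / 2 * (1 - t) * (N (v - w))\<^sup>2 \<le> ?h v - ?h w" if t: "0 < t" "t < 1" for t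
  proof -
    let ?y = "(1 - t) *\<^sub>R w + t *\<^sub>R v"
    have "?h w \<le> ?h ?y"
      using convex_combination(1)[OF w v] t by (intro min) auto
    also have "\<dots> \<le> g \<bullet> ?y + c / 2 * (N (?y - z))\<^sup>2 + ((1 - t) * p w + t * p v)"
      using convex_combination(2)[OF w v, of t] t by simp
    also have "(N (?y - z))\<^sup>2 = (1 - t) * (N (w - z))\<^sup>2 + t * (N (v - z))\<^sup>2 - t * (1 - t) * (N (v - w))\<^sup>2"
      unfolding wnorm_power2[OF L_pos] wscale_simps
      by (simp add: inner_diff inner_add inner_commute algebra_simps)
    also have "g \<bullet> ?y = (1 - t) * (g \<bullet> w) + t * (g \<bullet> v)"
      by (simp add: inner_add)
    finally have "t * (c / 2 * (1 - t) * (N (v - w))\<^sup>2) \<le> t * (?h v - ?h w)"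
      by (simp add: algebra_simps diff_divide_distrib)
    then show ?thesis
      using t by (simp only: mult_le_cancel_left_pos)
  qed
  have "((\<lambda>t. c / 2 * (1 - t) * (N (v - w))\<^sup>2) \<longlongrightarrow> c / 2 * (1 - 0) * (N (v - w))\<^sup>2) (at_right 0)"
    by (intro tendsto_intros)
  moreover have "\<forall>\<^sub>F t in at_right 0. c / 2 * (1 - t) * (N (v - w))\<^sup>2 \<le> ?h v - ?h w"
    unfolding eventually_at_right_field using ineq by (intro exI[of _ 1]) auto
  ultimately have "c / 2 * (1 - 0) * (N (v - w))\<^sup>2 \<le> ?h v - ?h w"
    by (rule tendsto_upperbound) simp
  then show ?thesis
    by simp
qed

text \<open>\<open>ARG_MIN\<close> is a choice operator, so attainment is what makes it a minimizer.
  The shift by y only adds a constant. Taking c = 1 covers the proximal gradient step and c =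
  \<open>theta k\<close> the APG step.\<close>

lemma arg_min_prox:
  fixes g y z :: "real^'n" and c :: real
  defines "h \<equiv> \<lambda>w. ereal (g \<bullet> (w - y) + c / 2 * (N (w - z))\<^sup>2) + psi w"
  assumes c: "0 < c"
  defines "w \<equiv> (ARG_MIN h w. True)"
  shows "w \<in> D"
    and "v \<in> D \<Longrightarrow> g \<bullet> w + c / 2 * (N (w - z))\<^sup>2 + p w + c / 2 * (N (v - w))\<^sup>2
      \<le> g \<bullet> v + c / 2 * (N (v - z))\<^sup>2 + p v"
proof -
  let ?q = "\<lambda>w. g \<bullet> w + c / 2 * (N (w - z))\<^sup>2 + p w"
  have h: "h w = (if w \<in> D then ereal (?q w - g \<bullet> y) else \<infinity>)" for w
    unfolding h_def by (subst psi_eq) (simp add: inner_diff_right algebra_simps)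
  obtain a where a: "a \<in> D" "\<And>v. v \<in> D \<Longrightarrow> ?q a \<le> ?q v"
    using prox_problem_attained[OF c] by blast
  then have "h a \<le> h v" for v
    using a(2)[of v] by (simp add: h add.assoc)
  then have "is_arg_min h (\<lambda>_. True) a"
    by (auto simp: is_arg_min_def not_less)
  then have "is_arg_min h (\<lambda>_. True) w"
    unfolding w_def arg_min_def by (rule someI)
  then have "\<not> h v < h w" for v
    by (simp add: is_arg_min_def)
  then have min: "h w \<le> h v" for v
    by (simp add: not_less)
  show w: "w \<in> D"
    using min[of a] a(1) by (auto simp: h split: if_splits)
  then have "?q w \<le> ?q v" if "v \<in> D" for v
    using min[of v] that by (simp add: h)
  then show "v \<in> D \<Longrightarrow> ?q w + c / 2 * (N (v - w))\<^sup>2 \<le> ?q v"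
    using three_point[OF w] by blast
qed

section \<open>The proximal gradient step\<close>

lemma prox_in_D: "prox x \<in> D"
  and prox_three_point: "v \<in> D \<Longrightarrow>
    gradient f x \<bullet> prox x + (N (prox x - x))\<^sup>2 / 2 + p (prox x) + (N (v - prox x))\<^sup>2 / 2
      \<le> gradient f x \<bullet> v + (N (v - x))\<^sup>2 / 2 + p v"
  using arg_min_prox[where c = 1 and g = "gradient f x" and y = x and z = x]
  unfolding prox_grad_def by simp_all

text \<open>The three-point inequality is combined with smoothness at \<open>prox x\<close> and with
  the tangent bound for f at v.\<close>

lemma prox_descent:
  assumes "v \<in> D"
  shows "F (prox x) + (N (v - prox x))\<^sup>2 / 2 \<le> F v + (N (v - x))\<^sup>2 / 2"
  using prox_three_point[OF assms, of x] f_upper[of "prox x" x] f_lower[of x v]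
  by (simp add: F_def inner_diff_right)

lemma prox_step_le_gap:
  assumes "x \<in> D"
  shows "(N (prox x - x))\<^sup>2 / 2 \<le> gapF x - gapF (prox x)"
  using prox_descent[OF assms, of x] gap_diff[OF assms prox_in_D, of x]
  by (simp add: wnorm_minus_commute[of L x "prox x"])

lemma gap_prox_le: "gapF (prox x) \<le> gapF x" if "x \<in> D"
  using prox_step_le_gap[OF that] zero_le_power2[of "N (prox x - x)"] by linarith

text \<open>The function \<open>f - \<langle>\<nabla>f(x), \<cdot>\<rangle>\<close> is minimal at \<open>x\<close>. Comparing \<open>x\<close> with the point
  \<open>y - t d\<close> bounds its derivative at \<open>y\<close>; the choice \<open>t = N (y - x) / N d\<close> gives the Lipschitz
  continuity of the gradient.\<close>

lemma gradient_lipschitz: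
  "(gradient f y - gradient f x) \<bullet> d \<le> N (y - x) * N d"
proof -
  let ?r = "N (y - x)" and ?q = "(gradient f y - gradient f x) \<bullet> d"
  have nonneg: "0 \<le> N w" for w
    by (simp add: wnorm_eq_norm[OF L_pos])
  have key: "t * ?q \<le> (t\<^sup>2 * (N d)\<^sup>2 + ?r\<^sup>2) / 2" for t
  proof -
    have "(N (t *\<^sub>R d))\<^sup>2 = t\<^sup>2 * (N d)\<^sup>2"
      unfolding wnorm_power2[OF L_pos] wscale_simps by (simp add: power2_eq_square)
    moreover have "N (y - t *\<^sub>R d - y) = N (t *\<^sub>R d)"
      by (simp add: wnorm_def)
    ultimately have "f (y - t *\<^sub>R d) \<le> f y - t * (gradient f y \<bullet> d) + t\<^sup>2 * (N d)\<^sup>2 / 2"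
      using f_upper[of "y - t *\<^sub>R d" y] by simp
    moreover have "f y \<le> f x + gradient f x \<bullet> (y - x) + ?r\<^sup>2 / 2"
      by (rule f_upper)
    moreover have "f x + gradient f x \<bullet> (y - t *\<^sub>R d - x) \<le> f (y - t *\<^sub>R d)"
      by (rule f_lower)
    ultimately show ?thesis
      by (simp add: inner_diff inner_diff_left inner_diff_right algebra_simps)
  qed
  show ?thesis
  proof (cases "N d = 0 \<or> ?r = 0")
    case True
    then have "d = 0 \<or> y = x"
      by (simp add: wnorm_eq_0_iff[OF L_pos])
    then show ?thesis
      by (auto simp: wnorm_def)
  next
    case False
    then have pos: "0 < N d" "0 < ?r"
      using nonneg by (auto simp: less_le)
    then have "(?r / N d)\<^sup>2 * (N d)\<^sup>2 = ?r\<^sup>2"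
      by (simp add: power_divide)
    then have "?r / N d * ?q \<le> ?r\<^sup>2"
      using key[of "?r / N d"] by simp
    then have "?r * ?q \<le> ?r * (?r * N d)"
      using pos(1) by (simp add: divide_simps power2_eq_square mult_ac)
    then show ?thesis
      using pos(2) by (simp only: mult_le_cancel_left_pos)
  qed
qed

text \<open>The optimality condition at \<open>prox x\<close> leaves two errors: the proximal
  displacement and the change of the gradient from x to \<open>prox x\<close>. Each contributes one
  product of norms, hence the factor 2.\<close>

lemma gap_prox_le_step:
  assumes "u \<in> sol"
  shows "gapF (prox x) \<le> 2 * N (prox x - x) * N (prox x - u)"
proof -
  let ?y = "prox x"
  have u: "u \<in> D"
    using assms sol_iff by blast
  have "gradient f x \<bullet> ?y + (N (?y - x))\<^sup>2 / 2 + p ?y + (N (u - ?y))\<^sup>2 / 2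
      \<le> gradient f x \<bullet> u + (N (u - x))\<^sup>2 / 2 + p u"
    by (rule prox_three_point[OF u])
  \<comment> \<open>With this expansion the squared norms in the three-point inequality cancel,
    leaving one inner product.\<close>
  moreover have "(N (u - x))\<^sup>2 = (N (?y - x))\<^sup>2 + (N (u - ?y))\<^sup>2 - 2 * (wscale L (?y - x) \<bullet> wscale L (?y - u))"
    unfolding wnorm_power2[OF L_pos] wscale_simps by (simp add: inner_diff inner_commute algebra_simps)
  moreover have "- (wscale L (?y - x) \<bullet> wscale L (?y - u)) \<le> N (?y - x) * N (?y - u)"
    using Cauchy_Schwarz_ineq2[of "wscale L (?y - x)" "wscale L (?y - u)"]
    by (simp add: wnorm_eq_norm[OF L_pos])
  moreover have "f ?y + gradient f ?y \<bullet> (u - ?y) \<le> f u"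
    by (rule f_lower)
  moreover have "(gradient f ?y - gradient f x) \<bullet> (?y - u) \<le> N (?y - x) * N (?y - u)"
    by (rule gradient_lipschitz)
  ultimately have "F ?y - F u \<le> 2 * (N (?y - x) * N (?y - u))"
    unfolding F_def inner_diff_right inner_diff_left by linarith
  then show ?thesis
    using gap_eq[OF prox_in_D assms] by (simp add: mult.assoc)
qed

section \<open>The accelerated methods\<close>

text \<open>The comparison point in \<open>prox_descent\<close> is the mixture of x and u with
  weight a. The update of z is exactly what makes its differences to \<open>prox y\<close> and y
  equal to a times u - z' and u - z.\<close>

lemma fista_step:
  fixes x z u :: "real^'n"
  assumes "x \<in> D" "u \<in> D" "0 < a" "a \<le> 1"
  defines "y \<equiv> (1 - a) *\<^sub>R x + a *\<^sub>R z"
  defines "z' \<equiv> z + (1 / a) *\<^sub>R (prox y - y)"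
  shows "F (prox y) + a\<^sup>2 / 2 * (N (u - z'))\<^sup>2 \<le> (1 - a) * F x + a * F u + a\<^sup>2 / 2 * (N (u - z))\<^sup>2"
proof -
  let ?w = "(1 - a) *\<^sub>R x + a *\<^sub>R u"
  have sc: "(N (a *\<^sub>R d))\<^sup>2 = a\<^sup>2 * (N d)\<^sup>2" for d
    unfolding wnorm_power2[OF L_pos] wscale_simps by (simp add: power2_eq_square)
  have "?w - prox y = a *\<^sub>R (u - z')" "?w - y = a *\<^sub>R (u - z)"
    using assms(3) by (simp_all add: y_def z'_def algebra_simps)
  moreover have "F (prox y) + (N (?w - prox y))\<^sup>2 / 2 \<le> F ?w + (N (?w - y))\<^sup>2 / 2"
    using assms convex_combination(1) by (intro prox_descent) auto
  moreover have "F ?w \<le> (1 - a) * F x + a * F u"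
    using assms F_convex by auto
  ultimately show ?thesis
    by (simp add: sc)
qed

text \<open>The proximal point is z', not x'. Smoothness is therefore used at x', and the
  three-point inequality for z' enters multiplied by a; x' stays in \<open>D\<close> as a mixture of
  x and z'.\<close>

lemma apg_step:
  fixes x z u :: "real^'n"
  assumes "x \<in> D" "u \<in> D" "0 < a" "a \<le> 1"
  defines "y \<equiv> (1 - a) *\<^sub>R x + a *\<^sub>R z"
  defines "z' \<equiv> (ARG_MIN (\<lambda>w. ereal (gradient f y \<bullet> (w - y) + a / 2 * (N (w - z))\<^sup>2) + psi w) w. True)"
  defines "x' \<equiv> y + a *\<^sub>R (z' - z)"
  shows "x' \<in> D"
    and "F x' + a\<^sup>2 / 2 * (N (u - z'))\<^sup>2 \<le> (1 - a) * F x + a * F u + a\<^sup>2 / 2 * (N (u - z))\<^sup>2"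
proof -
  let ?g = "gradient f y"
  have sc: "(N (a *\<^sub>R d))\<^sup>2 = a\<^sup>2 * (N d)\<^sup>2" for d
    unfolding wnorm_power2[OF L_pos] wscale_simps by (simp add: power2_eq_square)
  have z': "z' \<in> D"
    and min: "?g \<bullet> z' + a / 2 * (N (z' - z))\<^sup>2 + p z' + a / 2 * (N (u - z'))\<^sup>2
      \<le> ?g \<bullet> u + a / 2 * (N (u - z))\<^sup>2 + p u"
    unfolding z'_def by (rule arg_min_prox[OF assms(3)] assms(2))+
  have x': "x' = (1 - a) *\<^sub>R x + a *\<^sub>R z'"
    by (simp add: x'_def y_def algebra_simps)
  show "x' \<in> D"
    unfolding x' using assms z' convex_combination(1) by auto
  have px: "p x' \<le> (1 - a) * p x + a * p z'"
    unfolding x' using assms z' convex_combination(2) by auto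
  have "x' - y = a *\<^sub>R (z' - z)"
    by (simp add: x'_def)
  then have fx: "f x' \<le> f y + ?g \<bullet> (x' - y) + a\<^sup>2 * (N (z' - z))\<^sup>2 / 2"
    using f_upper[of x' y] by (simp add: sc)
  have gx: "?g \<bullet> (x' - y) = (1 - a) * (?g \<bullet> (x - y)) + a * (?g \<bullet> (z' - y))"
    unfolding x' by (simp add: inner_diff_right inner_add_right algebra_simps)
  have 1: "(1 - a) * (f y + ?g \<bullet> (x - y)) \<le> (1 - a) * f x"
    using f_lower assms(4) by (intro mult_left_mono) auto
  have 2: "a * (?g \<bullet> (z' - y) + a / 2 * (N (z' - z))\<^sup>2 + p z' + a / 2 * (N (u - z'))\<^sup>2 + f y)
      \<le> a * (f u + a / 2 * (N (u - z))\<^sup>2 + p u)"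
    using min f_lower[of y u] assms(3) by (intro mult_left_mono) (auto simp: inner_diff_right)
  show "F x' + a\<^sup>2 / 2 * (N (u - z'))\<^sup>2 \<le> (1 - a) * F x + a * F u + a\<^sup>2 / 2 * (N (u - z))\<^sup>2"
    using px fx 1 2 unfolding gx F_def by (simp add: algebra_simps power2_eq_square)
qed

text \<open>The comparison point \<open>u\<close> is arbitrary: a minimizer gives the rate, \<open>u = X 0\<close> gives
  monotonicity.\<close>

lemma accelerated_bound:
  assumes "u \<in> D" "Z 0 = X 0" "X 0 \<in> D"
    and inD: "\<And>k. X k \<in> D \<Longrightarrow> X (Suc k) \<in> D"
    and step: "\<And>k. X k \<in> D \<Longrightarrow>
      F (X (Suc k)) + (theta k)\<^sup>2 / 2 * (N (u - Z (Suc k)))\<^sup>2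
        \<le> (1 - theta k) * F (X k) + theta k * F u + (theta k)\<^sup>2 / 2 * (N (u - Z k))\<^sup>2"
  shows "X k \<in> D"
    and "F (X (Suc k)) - F u + (theta k)\<^sup>2 / 2 * (N (u - Z (Suc k)))\<^sup>2
      \<le> (theta k)\<^sup>2 / 2 * (N (u - X 0))\<^sup>2"
proof -
  show D: "X k \<in> D" for k
    by (induction k) (use assms in auto)
  show "F (X (Suc k)) - F u + (theta k)\<^sup>2 / 2 * (N (u - Z (Suc k)))\<^sup>2
      \<le> (theta k)\<^sup>2 / 2 * (N (u - X 0))\<^sup>2"
  proof (induction k)
    case 0
    then show ?case
      using step[OF D, of 0] assms(2) by simp
  next
    case (Suc k)
    let ?b = "theta (Suc k)" and ?d = "(N (u - Z (Suc k)))\<^sup>2"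
    have "F (X (Suc (Suc k))) - F u + ?b\<^sup>2 / 2 * (N (u - Z (Suc (Suc k))))\<^sup>2
        \<le> (1 - ?b) * (F (X (Suc k)) - F u) + ?b\<^sup>2 / 2 * ?d"
      using step[OF D, of "Suc k"] by (simp add: algebra_simps)
    also have "\<dots> \<le> (1 - ?b) * ((theta k)\<^sup>2 / 2 * (N (u - X 0))\<^sup>2 - (theta k)\<^sup>2 / 2 * ?d) + ?b\<^sup>2 / 2 * ?d"
      using Suc.IH theta_le_1 by (intro add_right_mono mult_left_mono) auto
    \<comment> \<open>The identity \<open>theta_Suc\<close> makes both terms in \<open>?d\<close>
      cancel.\<close>
    also have "\<dots> = ?b\<^sup>2 / 2 * (N (u - X 0))\<^sup>2"
      unfolding theta_Suc by (simp add: algebra_simps)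
    finally show ?case .
  qed
qed

definition pass :: "bool \<Rightarrow> real^'n \<Rightarrow> nat \<Rightarrow> real^'n" where
  "pass b x K = (if b then fista f psi L x K else apg f psi L x K)"

lemma pass_bound:
  assumes x: "x \<in> D" and K: "1 \<le> K"
  shows "pass b x K \<in> D"
    and "u \<in> D \<Longrightarrow> F (pass b x K) - F u \<le> (theta (K - 1))\<^sup>2 / 2 * (N (x - u))\<^sup>2"
proof -
  define S where "S = (if b then fista_iter f psi L x else apg_iter f psi L x)"
  define X Z where "X = (\<lambda>k. fst (S k))" and "Z = (\<lambda>k. snd (S k))"
  have 0: "Z 0 = X 0" "X 0 = x"
    by (simp_all add: X_def Z_def S_def)
  have inD: "X (Suc k) \<in> D" if "X k \<in> D" for k
  proof (cases b)
    case True
    then show ?thesis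
      by (simp add: X_def S_def Let_def split_beta prox_in_D)
  next
    case False
    then show ?thesis
      using apg_step(1)[OF that that theta_pos theta_le_1, where z = "Z k"]
      by (simp add: X_def Z_def S_def Let_def split_beta)
  qed
  have step: "F (X (Suc k)) + (theta k)\<^sup>2 / 2 * (N (u - Z (Suc k)))\<^sup>2
      \<le> (1 - theta k) * F (X k) + theta k * F u + (theta k)\<^sup>2 / 2 * (N (u - Z k))\<^sup>2"
    if "X k \<in> D" "u \<in> D" for k u
  proof (cases b)
    case True
    then show ?thesis
      using fista_step[OF that theta_pos theta_le_1, where z = "Z k"]
      by (simp add: X_def Z_def S_def Let_def split_beta)
  next
    case False
    then show ?thesis
      using apg_step(2)[OF that theta_pos theta_le_1, where z = "Z k"]
      by (simp add: X_def Z_def S_def Let_def split_beta)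
  qed
  have pass: "pass b x K = X K"
    by (simp add: pass_def X_def S_def fista_def apg_def)
  have X0: "X 0 \<in> D"
    using x 0 by simp
  show "pass b x K \<in> D"
    unfolding pass using accelerated_bound(1)[where X = X and Z = Z, OF x 0(1) X0 inD step[OF _ x]] by blast
  assume u: "u \<in> D"
  \<comment> \<open>After k + 1 steps the bound carries \<open>theta k\<close>, which is the origin
    of the index K - 1.\<close>
  obtain k where k: "K = Suc k"
    using K by (cases K) auto
  have "F (X (Suc k)) - F u + (theta k)\<^sup>2 / 2 * (N (u - Z (Suc k)))\<^sup>2
      \<le> (theta k)\<^sup>2 / 2 * (N (u - X 0))\<^sup>2"
    using accelerated_bound(2)[where X = X and Z = Z, OF u 0(1) X0 inD step[OF _ u]] by blast
  moreover have "0 \<le> (theta k)\<^sup>2 / 2 * (N (u - Z (Suc k)))\<^sup>2"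
    by simp
  ultimately show "F (pass b x K) - F u \<le> (theta (K - 1))\<^sup>2 / 2 * (N (x - u))\<^sup>2"
    unfolding pass unfolding k 0(2) wnorm_minus_commute[of L x u] diff_Suc_1 by linarith
qed

lemma gap_pass_le: "gapF (pass b x K) \<le> gapF x" if "x \<in> D" "1 \<le> K"
  using pass_bound(2)[OF that that(1), of b] gap_diff[OF pass_bound(1)[OF that, of b] that(1)]
  by (simp add: wnorm_def)

end

section \<open>Adaptive restart\<close>

text \<open>Here \<open>mu\<close> stands for the error bound constant at x0, with the error bound
  restated for real gaps. The upper limit on \<open>eps\<close> makes the logarithm of 2 gap / eps
  positive.\<close>

locale adaptive_restart = composite f psi L
  for f :: "real^'n \<Rightarrow> real" and psi :: "real^'n \<Rightarrow> ereal" and L :: "real^'n" +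
  fixes x0 :: "real^'n" and mu eps mu0 :: real and use_fista :: "nat \<Rightarrow> nat \<Rightarrow> bool"
  assumes x0_in_D: "x0 \<in> eff_dom psi"
    and mu_pos: "0 < mu"
    and error_bound: "\<And>x. x \<in> eff_dom psi \<Longrightarrow> gap (objective f psi) x \<le> gap (objective f psi) x0 \<Longrightarrow>
      mu / 2 * (wdist L x (minimizers (objective f psi)))\<^sup>2 \<le> gap (objective f psi) x"
    and eps_pos: "0 < eps"
    and mu0_pos: "0 < mu0"
    and admissible: "1 \<le> restart_period mu0"
    and eps_less: "eps < 2 * gap (objective f psi) x0"
begin

abbreviation "mus s \<equiv> stage_mu mu0 s"
abbreviation "Ks s \<equiv> restart_period (mus s)"
definition "q s = (theta (Ks s - 1))\<^sup>2 / mus s"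

text \<open>The stopping test between stages is left out, so that an infinite trace can be built
  first and cut off at the first stage that meets the test.\<close>

definition stage :: "(nat \<Rightarrow> nat \<Rightarrow> real^'n) \<Rightarrow> (nat \<Rightarrow> nat) \<Rightarrow> nat \<Rightarrow> bool" where
  "stage x T s \<longleftrightarrow> (\<forall>t<T s. x s (Suc t) = pass (use_fista s t) (x s t) (Ks s)) \<and> 1 \<le> T s \<and>
     stage_exit f psi L eps mu0 x0 x T s (T s) \<and>
     (\<forall>t. 1 \<le> t \<and> t < T s \<longrightarrow> \<not> stage_exit f psi L eps mu0 x0 x T s t) \<and>
     x (Suc s) 0 = prox (x s (T s))"

lemma adares_run_iff:
  "adares_run f psi L eps mu0 use_fista x0 xhat shat Nhat \<longleftrightarrow>
    (\<exists>x T. x 0 0 = prox x0 \<and>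
      (\<forall>s\<le>shat. stage x T s \<and> ((N (x (Suc s) 0 - x s (T s)))\<^sup>2 \<le> eps \<longleftrightarrow> s = shat)) \<and>
      xhat = prox (x shat (T shat)) \<and> Nhat = 1 + (\<Sum>s\<le>shat. T s * Ks s + 1))"
  by (simp only: adares_run_def stage_def pass_def conj_assoc)

section \<open>Stage parameters and the consequences of the error bound\<close>

lemma stage_mu_pos: "0 < mus s"
  using mu0_pos by (simp add: stage_mu_def)

lemma stage_mu_le: "mus s \<le> mu0"
  using mu0_pos by (simp add: stage_mu_def divide_simps)

lemma Ks_ge_1: "1 \<le> Ks s"
  using restart_period_antimono[OF stage_mu_pos stage_mu_le] admissible le_trans by blast

lemma q_nonneg: "0 \<le> q s"
  using stage_mu_pos by (simp add: q_def less_imp_le)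

lemma q_le: "q s \<le> exp (-1)"
  unfolding q_def by (rule theta_restart_period[OF stage_mu_pos Ks_ge_1])

lemma q_power_le: "q s ^ t \<le> exp (- real t)"
proof -
  have "q s ^ t \<le> exp (-1) ^ t"
    by (rule power_mono[OF q_le q_nonneg])
  also have "\<dots> = exp (- real t)"
    by (simp add: exp_of_nat_mult[symmetric])
  finally show ?thesis .
qed

text \<open>The accelerated rate holds for every minimizer u. Its square root is linear in the
  distance to u and thus passes to the infimum, after which the error bound turns distance into
  gap.\<close>

lemma gap_pass_contract:
  assumes x: "x \<in> D" "gapF x \<le> gapF x0" and s: "mus s \<le> mu"
  shows "gapF (pass b x (Ks s)) \<le> q s * gapF x"
proof -
  let ?y = "pass b x (Ks s)" and ?a = "theta (Ks s - 1)" and ?w = "wdist L x sol"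
  have y: "?y \<in> D"
    using pass_bound(1)[OF x(1) Ks_ge_1] .
  have a: "0 < ?a"
    by (rule theta_pos)
  have "sqrt (2 * gapF ?y) / ?a \<le> ?w"
  proof (rule le_wdist[OF minimizers_nonempty])
    fix u assume u: "u \<in> sol"
    have "gapF ?y \<le> ?a\<^sup>2 / 2 * (N (x - u))\<^sup>2"
      using pass_bound(2)[OF x(1) Ks_ge_1] u sol_iff gap_eq[OF y u] by simp
    then have "sqrt (2 * gapF ?y) \<le> sqrt ((?a * N (x - u))\<^sup>2)"
      by (intro real_sqrt_le_mono) (simp add: power_mult_distrib)
    also have "\<dots> = ?a * N (x - u)"
      using a by (simp add: wnorm_eq_norm[OF L_pos])
    finally show "sqrt (2 * gapF ?y) / ?a \<le> N (x - u)"
      using a by (simp add: divide_simps mult.commute)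
  qed
  then have "sqrt (2 * gapF ?y) \<le> ?a * ?w"
    using a by (simp add: divide_simps mult.commute)
  then have "(sqrt (2 * gapF ?y))\<^sup>2 \<le> (?a * ?w)\<^sup>2"
    using gap_nonneg[OF y] by (intro power_mono) auto
  then have "gapF ?y \<le> ?a\<^sup>2 / 2 * ?w\<^sup>2"
    using gap_nonneg[OF y] by (simp add: power_mult_distrib)
  also have "\<dots> = ?a\<^sup>2 / mu * (mu / 2 * ?w\<^sup>2)"
    using mu_pos by simp
  also have "\<dots> \<le> ?a\<^sup>2 / mu * gapF x"
    using error_bound[OF x] mu_pos by (intro mult_left_mono) auto
  also have "\<dots> \<le> ?a\<^sup>2 / mus s * gapF x"
    using s stage_mu_pos[of s] gap_nonneg[OF x(1)] mu_pos
    by (intro mult_right_mono divide_left_mono) auto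
  finally show ?thesis
    by (simp add: q_def)
qed

text \<open>With g the gap, r the step and w the distance after it, g \<le> 2 r w and mu w^2 \<le> 2
  g. Eliminating w and cancelling one factor g produces the constant 8.\<close>

lemma gap_prox_le_power2:
  assumes "gapF (prox x) \<le> gapF x0"
  shows "gapF (prox x) \<le> 8 * (N (prox x - x))\<^sup>2 / mu"
proof (cases "gapF (prox x) = 0")
  case True
  then show ?thesis
    using mu_pos by simp
next
  case False
  let ?g = "gapF (prox x)" and ?r = "N (prox x - x)" and ?w = "wdist L (prox x) sol"
  have g: "0 < ?g"
    using False gap_nonneg[OF prox_in_D, of x] by simp
  obtain u where "u \<in> sol"
    using minimizers_nonempty by blast
  then have "?r \<noteq> 0"
    using gap_prox_le_step[of u x] g by auto
  then have r: "0 < ?r"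
    by (simp add: wnorm_eq_norm[OF L_pos])
  have "?g / (2 * ?r) \<le> ?w"
    using gap_prox_le_step r by (intro le_wdist[OF minimizers_nonempty]) (simp add: divide_simps mult_ac)
  then have "(?g / (2 * ?r))\<^sup>2 \<le> ?w\<^sup>2"
    using g r by (intro power_mono) auto
  then have "mu / 2 * (?g / (2 * ?r))\<^sup>2 \<le> mu / 2 * ?w\<^sup>2"
    using mu_pos by (intro mult_left_mono) auto
  also have "\<dots> \<le> ?g"
    by (rule error_bound[OF prox_in_D assms])
  finally have "?g * (mu * ?g) \<le> ?g * (8 * ?r\<^sup>2)"
    using r by (simp add: power_divide power_mult_distrib divide_simps power2_eq_square mult_ac)
  then have "mu * ?g \<le> 8 * ?r\<^sup>2"
    using g by (simp only: mult_le_cancel_left_pos)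
  then show ?thesis
    using mu_pos by (simp add: divide_simps mult.commute)
qed

text \<open>A real bound strict at the integer t gives t + 1 below the ceiling. Applied to the last
  pass before exit, this bounds the whole stage length.\<close>

lemma le_ceiling_ln:
  assumes "eps < A * exp (- real t)"
  shows "real (Suc t) \<le> of_int \<lceil>ln (A / eps)\<rceil>"
proof -
  have "exp (real t) < A / eps"
    using assms eps_pos by (simp add: exp_minus divide_simps mult.commute)
  then have "real t < ln (A / eps)"
    using ln_less_cancel_iff[of "exp (real t)" "A / eps"] by (metis exp_gt_zero ln_exp order_less_trans)
  then have "int t < \<lceil>ln (A / eps)\<rceil>"
    by (simp add: less_ceiling_iff)
  then show ?thesis
    by linarith
qed

subsection \<open>Length of a stage\<close>

context
  fixes x :: "nat \<Rightarrow> nat \<Rightarrow> real^'n" and T :: "nat \<Rightarrow> nat" and n :: nat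
  assumes start: "x 0 0 = prox x0"
    and stages: "\<And>s. s \<le> n \<Longrightarrow> stage x T s"
begin

abbreviation "prev s \<equiv> prev_point x0 x T s"
abbreviation "res s t \<equiv> (N (prox (x s t) - x s t))\<^sup>2"

lemma stage_start: "s \<le> n \<Longrightarrow> x s 0 = prox (prev s)"
  using start stages[of "s - 1"] by (cases s) (auto simp: prev_point_def stage_def)

lemma iterates:
  assumes "s \<le> n" "prev s \<in> D" "gapF (prev s) \<le> gapF x0" "t \<le> T s"
  shows "x s t \<in> D \<and> gapF (x s t) \<le> gapF x0"
  using assms(4)
proof (induction t)
  case 0
  then show ?case
    using stage_start[OF assms(1)] prox_in_D gap_prox_le[OF assms(2)] assms(3) by simp
next
  case (Suc t)
  then have "x s (Suc t) = pass (use_fista s t) (x s t) (Ks s)"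
    using stages[OF assms(1)] by (simp add: stage_def)
  then show ?case
    using Suc pass_bound(1) gap_pass_le Ks_ge_1 by (metis Suc_leD order_trans)
qed

lemma prev_bounded: "s \<le> n \<Longrightarrow> prev s \<in> D \<and> gapF (prev s) \<le> gapF x0"
proof (induction s)
  case 0
  then show ?case
    using x0_in_D by (simp add: prev_point_def)
next
  case (Suc s)
  then show ?case
    using iterates[of s "T s"] by (simp add: prev_point_def)
qed

lemma iterate_bounded: "x s t \<in> D" "gapF (x s t) \<le> gapF x0" if "s \<le> n" "t \<le> T s"
  using iterates[OF that(1) _ _ that(2)] prev_bounded[OF that(1)] by blast+

lemma res_le: "res s t \<le> 2 * gapF (x s t)" if "s \<le> n" "t \<le> T s"
  using prox_step_le_gap[OF iterate_bounded(1)[OF that]] gap_nonneg[OF prox_in_D, of "x s t"] by linarith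

lemma fast_stage_gap:
  assumes "s \<le> n" "mus s \<le> mu" "t \<le> T s"
  shows "gapF (x s t) \<le> q s ^ t * gapF (x s 0)"
  using assms(3)
proof (induction t)
  case (Suc t)
  then have "x s (Suc t) = pass (use_fista s t) (x s t) (Ks s)"
    using stages[OF assms(1)] by (simp add: stage_def)
  then have "gapF (x s (Suc t)) \<le> q s * gapF (x s t)"
    using gap_pass_contract iterate_bounded assms Suc.prems by simp
  also have "\<dots> \<le> q s * (q s ^ t * gapF (x s 0))"
    using Suc by (intro mult_left_mono q_nonneg) auto
  finally show ?case
    by (simp add: mult.assoc)
qed simp

text \<open>The residual is at most twice the gap, the gap contracts by \<open>q s\<close> per pass,
  and its initial value is at most 8/mu times the squared first step. The factor 16 of
  \<open>stage_const\<close> arises as 2 * 8, so the first exit alternative fails.\<close>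

lemma fast_stage_exit:
  assumes "s \<le> n" "mus s \<le> mu"
  shows "res s (T s) \<le> eps"
proof -
  let ?t = "T s" and ?r = "(N (x s 0 - prev s))\<^sup>2"
  have "gapF (x s 0) \<le> 8 * ?r / mu"
    using gap_prox_le_power2[of "prev s"] iterate_bounded(2)[OF assms(1), of 0] stage_start[OF assms(1)]
    by simp
  also have "\<dots> \<le> 8 * ?r / mus s"
    using assms(2) stage_mu_pos mu_pos by (intro divide_left_mono) auto
  finally have "res s ?t \<le> 2 * (q s ^ ?t * (8 * ?r / mus s))"
    using res_le[OF assms(1), of ?t] fast_stage_gap[OF assms, of ?t] q_nonneg[of s]
      mult_left_mono[of "gapF (x s 0)" "8 * ?r / mus s" "q s ^ ?t"] by fastforce
  also have "\<dots> = stage_const L mu0 x0 x T s * q s ^ ?t"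
    by (simp add: stage_const_def)
  finally show ?thesis
    using stages[OF assms(1)] by (simp add: stage_def stage_exit_def q_def)
qed

lemma not_exit_before:
  assumes "s \<le> n" "t < T s" "t \<noteq> 0"
  shows "eps < res s t" "res s t \<le> stage_const L mu0 x0 x T s * q s ^ t"
  using stages[OF assms(1)] assms(2,3) by (auto simp: stage_def stage_exit_def q_def Suc_le_eq)

lemma fast_stage_length:
  assumes "s \<le> n" "mus s \<le> mu"
  shows "real (T s) \<le> of_int \<lceil>ln (2 * gapF x0 / eps)\<rceil>"
proof -
  obtain t where t: "T s = Suc t"
    using stages[OF assms(1)] by (cases "T s") (auto simp: stage_def)
  have "eps < 2 * gapF x0 * exp (- real t)"
  \<comment> \<open>No exit test precedes the first pass, so a stage of one pass relies on
    \<open>eps_less\<close> instead.\<close>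
  proof (cases "t = 0")
    case True
    then show ?thesis
      using eps_less by simp
  next
    case False
    have "gapF (x s t) \<le> q s ^ t * gapF (x s 0)"
      using fast_stage_gap[OF assms] t by simp
    also have "\<dots> \<le> exp (- real t) * gapF x0"
      using q_power_le iterate_bounded[OF assms(1), of 0] gap_nonneg by (intro mult_mono) auto
    finally show ?thesis
      using not_exit_before(1)[OF assms(1) _ False] res_le[OF assms(1), of t] t by (simp add: mult.commute)
  qed
  then show ?thesis
    unfolding t by (rule le_ceiling_ln)
qed

text \<open>No contraction of the gap is available here. The failed exit test itself bounds the
  residual by \<open>stage_const\<close> times \<open>q s ^ t\<close>, and the first step of the
  stage is controlled by the gap at x0.\<close>

lemma slow_stage_length:
  assumes "s \<le> n" "mu < mus s"
  shows "real (T s) \<le> of_int \<lceil>ln (32 * gapF x0 / (eps * mu))\<rceil>"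
proof -
  obtain t where t: "T s = Suc t"
    using stages[OF assms(1)] by (cases "T s") (auto simp: stage_def)
  have g0: "0 < gapF x0"
    using eps_pos eps_less by linarith
  have "eps < 32 * gapF x0 / mu * exp (- real t)"
  proof (cases "t = 0")
    case True
    have "mu < 16"
      using assms(2) stage_mu_le[of s] restart_period_pos_imp_less[OF mu0_pos admissible] by linarith
    then have "2 * gapF x0 < 32 * gapF x0 / mu"
      using mu_pos g0 by (simp add: divide_simps)
    then show ?thesis
      using True eps_less by simp
  next
    case False
    let ?r = "(N (x s 0 - prev s))\<^sup>2"
    have prev: "prev s \<in> D" "gapF (prev s) \<le> gapF x0"
      using prev_bounded[OF assms(1)] by blast+
    have "?r \<le> 2 * gapF x0"
      using prox_step_le_gap[OF prev(1)] gap_nonneg[OF prox_in_D, of "prev s"] prev(2)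
      unfolding stage_start[OF assms(1)] by linarith
    then have "16 * ?r / mus s \<le> 32 * gapF x0 / mu"
      using assms(2) mu_pos g0 by (intro frac_le) auto
    then have "stage_const L mu0 x0 x T s * q s ^ t \<le> 32 * gapF x0 / mu * exp (- real t)"
      unfolding stage_const_def using q_power_le q_nonneg g0 mu_pos by (intro mult_mono) auto
    then show ?thesis
      using not_exit_before[OF assms(1) _ False] t by simp
  qed
  then have "real (T s) \<le> of_int \<lceil>ln (32 * gapF x0 / mu / eps)\<rceil>"
    unfolding t by (rule le_ceiling_ln)
  then show ?thesis
    by (simp add: mult.commute)
qed

end

subsection \<open>Existence of a run\<close>

text \<open>Once \<open>C * q s ^ t\<close> is below \<open>eps\<close>, every value of
  \<open>r t\<close> meets one of the two alternatives.\<close>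

lemma eventually_exit: "\<exists>t\<ge>1. r t > C * q s ^ t \<or> r t \<le> eps"
proof -
  have "q s < 1"
    using q_le[of s] by (rule le_less_trans) simp
  then have "(\<lambda>t. C * q s ^ t) \<longlonglongrightarrow> C * 0"
    using q_nonneg by (intro tendsto_intros LIMSEQ_power_zero) auto
  then have "\<forall>\<^sub>F t in sequentially. C * q s ^ t < eps"
    using eps_pos by (intro order_tendstoD(2)) auto
  then obtain t where "\<And>t'. t \<le> t' \<Longrightarrow> C * q s ^ t' < eps"
    unfolding eventually_sequentially by blast
  then have "C * q s ^ max 1 t < eps"
    by simp
  then show ?thesis
    by (intro exI[of _ "max 1 t"]) auto
qed

text \<open>Iterates and stage lengths depend on each other, but a whole stage is determined by the
  point b preceding it. Recursion on that point (\<open>pv\<close>) untangles them;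
  \<open>ex\<close> is the exit test expressed through b.\<close>

lemma infinite_trace_exists:
  obtains x T where "x 0 0 = prox x0" "\<And>s. stage x T s"
proof -
  define it where "it = (\<lambda>s a. rec_nat a (\<lambda>t v. pass (use_fista s t) v (Ks s)))"
  define ex where "ex = (\<lambda>s b t. 1 \<le> t \<and>
    ((N (prox (it s (prox b) t) - it s (prox b) t))\<^sup>2 > 16 * (N (prox b - b))\<^sup>2 / mus s * q s ^ t
     \<or> (N (prox (it s (prox b) t) - it s (prox b) t))\<^sup>2 \<le> eps))"
  define len where "len = (\<lambda>s b. LEAST t. ex s b t)"
  define pv where "pv = rec_nat x0 (\<lambda>s b. it s (prox b) (len s b))"
  define x where "x = (\<lambda>s. it s (prox (pv s)))"
  define T where "T = (\<lambda>s. len s (pv s))"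
  have it: "it s a 0 = a" "it s a (Suc t) = pass (use_fista s t) (it s a t) (Ks s)" for s a t
    by (simp_all add: it_def)
  have prev: "prev_point x0 x T s = pv s" for s
    by (cases s) (simp_all add: prev_point_def pv_def x_def T_def)
  have exit: "ex s (pv s) t \<longleftrightarrow> 1 \<le> t \<and> stage_exit f psi L eps mu0 x0 x T s t" for s t
    unfolding ex_def stage_exit_def stage_const_def prev q_def[symmetric] by (simp add: x_def it)
  have least: "ex s (pv s) (T s)" for s
    unfolding T_def len_def
    by (rule LeastI_ex) (unfold ex_def, rule eventually_exit)
  have before: "\<not> ex s (pv s) t" if "t < T s" for s t
    using that unfolding T_def len_def by (rule not_less_Least)
  have "x (Suc s) 0 = prox (x s (T s))" for s
    by (simp add: x_def it pv_def T_def)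
  then have "stage x T s" for s
    unfolding stage_def using least[of s] before[of _ s] by (auto simp: exit x_def it)
  moreover have "x 0 0 = prox x0"
    by (simp add: x_def it pv_def)
  ultimately show ?thesis
    using that by blast
qed

lemma run_exists: "\<exists>xhat shat Nhat. adares_run f psi L eps mu0 use_fista x0 xhat shat Nhat"
proof -
  obtain x T where x: "x 0 0 = prox x0" "\<And>s. stage x T s"
    using infinite_trace_exists by blast
  let ?P = "\<lambda>s. (N (x (Suc s) 0 - x s (T s)))\<^sup>2 \<le> eps"
  obtain m where "mu0 / mu < 2 ^ m"
    using real_arch_pow[of 2 "mu0 / mu"] by auto
  then have m: "mus m \<le> mu"
    using mu_pos by (simp add: stage_mu_def field_simps)
  have "?P m"
    using fast_stage_exit[OF x, of m m] m x(2)[of m] by (simp add: stage_def)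
  \<comment> \<open>The run stops at the least such stage; minimality gives the failure of the test
    at all earlier ones.\<close>
  then have "?P (LEAST s. ?P s)"
    by (rule LeastI)
  then have "\<forall>s\<le>(LEAST s. ?P s). ?P s \<longleftrightarrow> s = (LEAST s. ?P s)"
    using Least_le[of ?P] by (auto intro: antisym)
  then show ?thesis
    unfolding adares_run_iff using x by blast
qed

subsection \<open>Counting the iterations\<close>

lemma count_fast:
  assumes run: "adares_run f psi L eps mu0 use_fista x0 xhat shat Nhat" and le: "mu0 \<le> mu"
  shows "real Nhat \<le> of_int \<lceil>2 * sqrt (exp 1 / mu0) - 1\<rceil> * of_int \<lceil>ln (2 * gapF x0 / eps)\<rceil> + 2"
proof -
  obtain x T where x: "x 0 0 = prox x0" "\<And>s. s \<le> shat \<Longrightarrow> stage x T s"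
    and stop: "\<And>s. s \<le> shat \<Longrightarrow> (N (x (Suc s) 0 - x s (T s)))\<^sup>2 \<le> eps \<longleftrightarrow> s = shat"
    and Nhat: "Nhat = 1 + (\<Sum>s\<le>shat. T s * Ks s + 1)"
    using run unfolding adares_run_iff by blast
  have mu0: "mus 0 = mu0"
    by (simp add: stage_mu_def)
  have "(N (x (Suc 0) 0 - x 0 (T 0)))\<^sup>2 \<le> eps"
    using fast_stage_exit[OF x, of shat 0] le mu0 x(2)[of 0] by (simp add: stage_def)
  then have "shat = 0"
    using stop[of 0] by simp
  then have "real Nhat = real (T 0) * real (restart_period mu0) + 2"
    by (simp add: Nhat mu0)
  also have "real (restart_period mu0) = of_int \<lceil>2 * sqrt (exp 1 / mu0) - 1\<rceil>"
    using admissible unfolding restart_period_def by simp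
  finally have N: "real Nhat = real (T 0) * of_int \<lceil>2 * sqrt (exp 1 / mu0) - 1\<rceil> + 2" .
  have "0 \<le> \<lceil>2 * sqrt (exp 1 / mu0) - 1\<rceil>"
    using admissible unfolding restart_period_def by linarith
  then show ?thesis
    unfolding N mult.commute[of "real (T 0)"] using fast_stage_length[OF x, of shat 0] le mu0
    by (intro add_right_mono mult_left_mono) auto
qed

text \<open>Halving the estimate multiplies the period bound by sqrt 2, so the sum is geometric. Its
  end term is the square root of 1/\<open>mus m\<close>, at most sqrt(2/mu).\<close>

lemma sum_periods_le:
  assumes "mu / 2 \<le> mus m"
  shows "(\<Sum>s<m. real (Ks s)) \<le> 2 * sqrt (exp 1) / (sqrt 2 - 1) * (sqrt (2 / mu) - sqrt (1 / mu0))"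
proof -
  let ?c = "2 * sqrt (exp 1) * sqrt (1 / mu0)"
  have "(\<Sum>s<m. real (Ks s)) \<le> (\<Sum>s<m. ?c * sqrt 2 ^ s)"
  proof (rule sum_mono)
    fix s
    have "exp 1 / mus s = exp 1 * (1 / mu0) * 2 ^ s"
      by (simp add: stage_mu_def)
    then have "sqrt (exp 1 / mus s) = sqrt (exp 1) * sqrt (1 / mu0) * sqrt 2 ^ s"
      by (simp only: real_sqrt_mult real_sqrt_power)
    then show "real (Ks s) \<le> ?c * sqrt 2 ^ s"
      using restart_period_le[OF stage_mu_pos[of s]] by simp
  qed
  also have "\<dots> = 2 * sqrt (exp 1) / (sqrt 2 - 1) * (sqrt (1 / mu0) * sqrt 2 ^ m - sqrt (1 / mu0))"
    unfolding sum_distrib_left[symmetric] by (subst geometric_sum) (simp_all add: field_simps)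
  also have "sqrt (1 / mu0) * sqrt 2 ^ m = sqrt (1 / mus m)"
    by (simp add: stage_mu_def real_sqrt_mult real_sqrt_divide real_sqrt_power)
  finally have "(\<Sum>s<m. real (Ks s)) \<le> 2 * sqrt (exp 1) / (sqrt 2 - 1) * (sqrt (1 / mus m) - sqrt (1 / mu0))" .
  moreover have "1 / mus m \<le> 2 / mu"
    using assms mu_pos stage_mu_pos[of m] by (simp add: divide_simps)
  then have "2 * sqrt (exp 1) / (sqrt 2 - 1) * (sqrt (1 / mus m) - sqrt (1 / mu0))
      \<le> 2 * sqrt (exp 1) / (sqrt 2 - 1) * (sqrt (2 / mu) - sqrt (1 / mu0))"
    by (intro mult_left_mono diff_right_mono real_sqrt_le_mono) simp_all
  ultimately show ?thesis
    by (rule order_trans)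
qed

lemma count_slow:
  assumes run: "adares_run f psi L eps mu0 use_fista x0 xhat shat Nhat" and gt: "mu < mu0"
  shows "real Nhat \<le> 1 + of_int \<lceil>log 2 (mu0 / mu)\<rceil>
    + 2 * sqrt (exp 1) / (sqrt 2 - 1) * (sqrt (2 / mu) - sqrt (1 / mu0))
      * of_int \<lceil>ln (32 * gapF x0 / (eps * mu))\<rceil>
    + of_int \<lceil>2 * sqrt (2 * exp 1) / sqrt mu\<rceil> * of_int \<lceil>ln (2 * gapF x0 / eps)\<rceil>"
    (is "_ \<le> 1 + ?l + ?A * ?M1 + ?B * ?M2")
proof -
  obtain x T where x: "x 0 0 = prox x0" "\<And>s. s \<le> shat \<Longrightarrow> stage x T s"
    and stop: "\<And>s. s \<le> shat \<Longrightarrow> (N (x (Suc s) 0 - x s (T s)))\<^sup>2 \<le> eps \<longleftrightarrow> s = shat"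
    and Nhat: "Nhat = 1 + (\<Sum>s\<le>shat. T s * Ks s + 1)"
    using run unfolding adares_run_iff by blast
  \<comment> \<open>This is the first stage whose estimate is at most \<open>mu\<close>. The
    preceding estimate exceeds \<open>mu\<close>, so stage m keeps at least half of it.\<close>
  define m where "m = nat \<lceil>log 2 (mu0 / mu)\<rceil>"
  have logpos: "0 < log 2 (mu0 / mu)"
    using gt mu_pos by simp
  then have l: "?l = real m"
    unfolding m_def by simp
  have m1: "1 \<le> m"
    using logpos unfolding m_def by linarith
  have "log 2 (mu0 / mu) \<le> real m"
    using l by linarith
  then have "mu0 / mu \<le> 2 powr real m"
    using mu_pos mu0_pos by (simp add: log_le_iff)
  then have fast: "mus m \<le> mu"
    using mu_pos by (simp add: stage_mu_def powr_realpow field_simps)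
  have slow: "mu < mus s" if "s < m" for s
  proof -
    have "real s < log 2 (mu0 / mu)"
      using that unfolding m_def by linarith
    then have "2 powr real s < mu0 / mu"
      using mu_pos mu0_pos by (simp add: less_log_iff)
    then show ?thesis
      using mu_pos by (simp add: stage_mu_def powr_realpow field_simps)
  qed
  have half: "mu / 2 \<le> mus m"
    using slow[of "m - 1"] m1 by (cases m) (auto simp: stage_mu_def)
  have shat: "shat \<le> m"
  proof (rule ccontr)
    assume "\<not> shat \<le> m"
    then have m: "m \<le> shat" "m \<noteq> shat"
      by auto
    have "(N (x (Suc m) 0 - x m (T m)))\<^sup>2 \<le> eps"
      using fast_stage_exit[OF x m(1) fast] x(2)[OF m(1)] by (simp add: stage_def)
    then show False
      using stop[OF m(1)] m(2) by simp
  qed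
  have M2: "1 \<le> ?M2"
    using le_ceiling_ln[of "2 * gapF x0" 0] eps_less by simp
  have B: "real (Ks m) \<le> ?B - 1"
  proof -
    have "exp 1 / mus m \<le> exp 1 / (mu / 2)"
      using half mu_pos stage_mu_pos[of m] by (intro divide_left_mono) auto
    then have "sqrt (exp 1 / mus m) \<le> sqrt (2 * exp 1 / mu)"
      by (intro real_sqrt_le_mono) (simp add: mult.commute)
    then have "2 * sqrt (exp 1 / mus m) - 1 \<le> 2 * sqrt (2 * exp 1) / sqrt mu - 1"
      by (simp add: real_sqrt_divide)
    then have "\<lceil>2 * sqrt (exp 1 / mus m) - 1\<rceil> \<le> \<lceil>2 * sqrt (2 * exp 1) / sqrt mu\<rceil> - 1"
      using ceiling_mono ceiling_diff_one by metis
    moreover have "1 \<le> \<lceil>2 * sqrt (exp 1 / mus m) - 1\<rceil>"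
      using Ks_ge_1[of m] unfolding restart_period_def by linarith
    ultimately show ?thesis
      unfolding restart_period_def by linarith
  qed
  have B0: "0 \<le> ?B"
    using B by linarith
  have slow_sum: "(\<Sum>s<k. real (T s * Ks s)) \<le> ?A * ?M1" if "1 \<le> k" "k \<le> m" "k \<le> Suc shat" for k
  proof -
    have len: "real (T s) \<le> ?M1" if "s < k" for s
      using that \<open>k \<le> m\<close> \<open>k \<le> Suc shat\<close> by (intro slow_stage_length[OF x] slow) auto
    \<comment> \<open>The sign of the ceiling is read off from the length of stage 0, which is why k
      is at least 1.\<close>
    then have M1: "0 \<le> ?M1"
      using \<open>1 \<le> k\<close> by (metis less_eq_Suc_le One_nat_def of_nat_0_le_iff order_trans)
    have "(\<Sum>s<k. real (T s * Ks s)) \<le> (\<Sum>s<k. ?M1 * real (Ks s))"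
      using len by (intro sum_mono) (simp add: mult_right_mono)
    also have "\<dots> \<le> (\<Sum>s<m. ?M1 * real (Ks s))"
      using \<open>k \<le> m\<close> M1 by (intro sum_mono2) auto
    also have "\<dots> = (\<Sum>s<m. real (Ks s)) * ?M1"
      unfolding sum_distrib_left[symmetric] by (rule mult.commute)
    also have "\<dots> \<le> ?A * ?M1"
      by (rule mult_right_mono[OF sum_periods_le[OF half] M1])
    finally show ?thesis .
  qed
  have N: "real Nhat = 2 + real shat + (\<Sum>s<Suc shat. real (T s * Ks s))"
    unfolding Nhat by (simp add: sum.distrib lessThan_Suc_atMost)
  \<comment> \<open>If the run ends before stage m, then 2 + shat \<le> 1 + m already fits. If it
    ends at m, the count is one too large, and the saving from \<open>?B - 1\<close> times
    \<open>?M2\<close> \<ge> 1 compensates.\<close>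
  show ?thesis
  proof (cases "shat < m")
    case True
    then have "real Nhat \<le> 1 + real m + ?A * ?M1"
      using N slow_sum[of "Suc shat"] by simp
    moreover have "0 \<le> ?B * ?M2"
      using B0 M2 by (intro mult_nonneg_nonneg) auto
    ultimately show ?thesis
      unfolding l by linarith
  next
    case False
    then have eq: "shat = m"
      using shat by simp
    have "real (T m * Ks m) \<le> ?M2 * (?B - 1)"
      unfolding of_nat_mult using fast_stage_length[OF x _ fast] eq B M2 by (intro mult_mono) auto
    also have "\<dots> = ?B * ?M2 - ?M2"
      by (simp add: algebra_simps)
    finally have "real (T m * Ks m) \<le> ?B * ?M2 - 1"
      using M2 by linarith
    then have "real Nhat \<le> 2 + real m + (?A * ?M1 + (?B * ?M2 - 1))"
      using slow_sum[of m] m1 unfolding N eq sum.lessThan_Suc by simp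
    then show ?thesis
      unfolding l by linarith
  qed
qed

end

theorem theorem2:
  fixes f :: "real^'n \<Rightarrow> real" and psi :: "real^'n \<Rightarrow> ereal"
    and L x0 :: "real^'n" and muF :: "real^'n \<Rightarrow> real^'n \<Rightarrow> real"
    and eps mu0 :: real and use_fista :: "nat \<Rightarrow> nat \<Rightarrow> bool"
  assumes f_convex: "convex_on UNIV f"
    and f_differentiable: "\<forall>x. f differentiable (at x)"
    and psi_proper: "proper_fun psi"
    and psi_closed: "closed_fun psi"
    and psi_convex: "convex_fun psi"
    and minimizers_nonempty: "minimizers (objective f psi) \<noteq> {}"
    and L_pos: "\<forall>i. L $ i > 0"
    and smoothness: "smooth_wrt f L"
    and error_bound: "local_quadratic_error_bound (objective f psi) L muF"
    and x0_dom: "x0 \<in> eff_dom (objective f psi)"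
    and eps_pos: "eps > 0"
    and mu0_pos: "mu0 > 0"
    and admissible_period: "restart_period mu0 \<ge> 1"
    and eps_less: "eps < 2 * gap (objective f psi) x0"
  shows "(\<exists>xhat shat Nhat. adares_run f psi L eps mu0 use_fista x0 xhat shat Nhat) \<and>
    (\<forall>xhat shat Nhat. adares_run f psi L eps mu0 use_fista x0 xhat shat Nhat \<longrightarrow>
       (mu0 \<le> muF L x0 \<longrightarrow>
          real Nhat \<le>
            of_int \<lceil>2 * sqrt (exp 1 / mu0) - 1\<rceil>
              * of_int \<lceil>ln (2 * gap (objective f psi) x0 / eps)\<rceil> + 2) \<and>
       (mu0 > muF L x0 \<longrightarrow>
          real Nhat \<le>
            1 + of_int \<lceil>log 2 (mu0 / muF L x0)\<rceil>
            + 2 * sqrt (exp 1) / (sqrt 2 - 1) * (sqrt (2 / muF L x0) - sqrt (1 / mu0))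
              * of_int \<lceil>ln (32 * gap (objective f psi) x0 / (eps * muF L x0))\<rceil>
            + of_int \<lceil>2 * sqrt (2 * exp 1) / sqrt (muF L x0)\<rceil>
              * of_int \<lceil>ln (2 * gap (objective f psi) x0 / eps)\<rceil>))"
proof -
  interpret composite f psi L
    using assms by unfold_locales auto
  let ?mu = "muF L x0"
  have x0: "x0 \<in> D"
    using x0_dom by (simp add: eff_dom_objective)
  have mu: "0 < ?mu"
    using error_bound x0_dom unfolding local_quadratic_error_bound_def by blast
  have eb: "?mu / 2 * (wdist L x sol)\<^sup>2 \<le> gapF x" if x: "x \<in> D" "gapF x \<le> gapF x0" for x
  proof -
    obtain u where u: "u \<in> sol"
      using minimizers_nonempty by blast
    have "objective f psi x \<le> objective f psi x0"
      using gap_diff[OF x(1) x0] x x0 by (simp add: objective_eq)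
    then have "objective f psi x \<ge> min_value (objective f psi) + ereal (?mu / 2 * (wdist L x sol)\<^sup>2)"
      using error_bound x0_dom unfolding local_quadratic_error_bound_def by blast
    then show ?thesis
      using x(1) gap_eq[OF x(1) u] by (simp add: objective_eq min_value_eq[OF u])
  qed
  interpret adaptive_restart f psi L x0 ?mu eps mu0 use_fista
    using x0 mu eb assms by unfold_locales auto
  show ?thesis
    using run_exists count_fast count_slow by blast
qed

end
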